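(* Let $Q$ be the true $m\times k$ $Q$-matrix, let $g\in[0,1]^m$ be known and let $c\in[0,1]^m$ be the true (unknown) parameter. Assume: (C1) $Q$ is complete; (C2) the $T$-matrices are saturated; (C3) $\mathbf A_1,\ldots,\mathbf A_N$ are i.i.d. random vectors in $\{0,1\}^k$ with $P(\mathbf A_r=\mathbf A)=p^*_{\mathbf A}$ for all $\mathbf A\in\{0,1\}^k$; (C4) $p^*_{\mathbf A}>0$ for every $\mathbf A\in\{0,1\}^k$ (including $\mathbf A=\mathbf 0$); (C5) each attribute is required by at least two items, i.e. every column of $Q$ contains at least two entries equal to $1$; for subject $r$ the responses are generated independently with $P(R_r^i=1\mid\xi_r^i)=c_i^{\xi_r^i}g_i^{1-\xi_r^i}$, where $\xi_r^i=\prod_{j=1}^k(A_r^j)^{Q_{ij}}$, $i=1,\ldots,m$; $c_i\ne g_i$ for all $i$; and $T_{c-g}(Q)\mathbf p^*$ does not have zero elements, where $\mathbf p^*=(p^*_{\mathbf A}:\mathbf A\in\{0,1\}^k\setminus\{\mathbf 0\})$. Let $$\hat Q_{\hat c}(g)=\arg\inf_{Q'}S_{\hat c(Q',g),g}(Q'),\qquad \tilde{\mathbf p}_{\hat c}(g)=\arg\inf_{\mathbf p}\bigl|T_{\hat c(\hat Q_{\hat c}(g),g),g}(\hat Q_{\hat c}(g))\mathbf p+p_{\mathbf 0}\mathbf g-\alpha\bigr|,$$ where the first infimum is over all candidate $m\times k$ $Q$-matrices $Q'$ and the second is subject to $\sum_{\mathbf A\in\{0,1\}^k}p_{\mathbf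 A}=1$. Then $$\lim_{N\to\infty}P(\hat Q_{\hat c}(g)\sim Q)=1.$$ Furthermore, if the estimator $\tilde c(Q,g)=\arg\inf_{c'\in[0,1]^m}S_{c',g}(Q)$ is consistent (for $c$), then, by appropriately rearranging the columns of $\hat Q_{\hat c}(g)$ (so that $\hat Q_{\hat c}(g)=Q$ whenever $\hat Q_{\hat c}(g)\sim Q$), for any $\varepsilon>0$, $$\lim_{N\to\infty}P(|\tilde{\mathbf p}_{\hat c}(g)-\mathbf p^*|\le\varepsilon)=1.$$
   Context: There are $m$ items and $k$ attributes, with $m,k$ known. A $Q$-matrix is an $m\times k$ binary matrix with no zero row (every item requires at least one attribute). Subject $r$ ($r=1,\ldots,N$) has an unobserved attribute vector $\mathbf A_r\in\{0,1\}^k$ and an observed response vector $\mathbf R_r=(R_r^1,\ldots,R_r^m)^\top\in\{0,1\}^m$; given $(\xi_r^1,\ldots,\xi_r^m)$ the responses $R_r^1,\ldots,R_r^m$ are jointly independent, and different subjects are independent. Convention: $0^0=1$. For a $Q$-matrix $Q'$ put $\xi^i_{Q'}(\mathbf A)=\prod_{j=1}^k(A^j)^{Q'_{ij}}$. For $c',g\in\mathbb R^m$, the columns of $T_{c',g}(Q')$ are indexed by $\mathbf A\in\{0,1\}^k\setminus\{\mathbf 0\}$, and its rows by combinations $I_{i_1}\wedge\cdots\wedge I_{i_l}$ of distinct items ($I_i$ stands for a positive response to item $i$); the corresponding entry is $\prod_{h=1}^l\bigl(g_{i_h}+(c'_{i_h}-g_{i_h})\xi^{i_h}_{Q'}(\mathbf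 A)\bigr)$. Saturated means that all combinations, $l=1,\ldots,m$, are included ($2^m-1$ rows). For $d\in\mathbb R^m$, $T_d(Q')=T_{d,0}(Q')$, i.e. entries $\prod_h d_{i_h}\xi^{i_h}_{Q'}(\mathbf A)$; $c-g$ is the componentwise difference. $\mathbf g$ is the column vector indexed like the rows of $T_{c',g}$ with entry $g_{i_1}\cdots g_{i_l}$ for $I_{i_1}\wedge\cdots\wedge I_{i_l}$; $\alpha$ is the column vector indexed the same way with entry $\frac1N\#\{r:R_r^{i_1}=\cdots=R_r^{i_l}=1\}$. $S_{c',g}(Q')=\inf|T_{c',g}(Q')\mathbf p+p_{\mathbf 0}\mathbf g-\alpha|$ ($|\cdot|$ the Euclidean norm), the infimum being over $\mathbf p=(p_{\mathbf A}:\mathbf A\neq\mathbf 0)$ and $p_{\mathbf 0}$ with $p_{\mathbf A}\in[0,1]$ for all $\mathbf A\in\{0,1\}^k$ and $\sum_{\mathbf A\in\{0,1\}^k}p_{\mathbf A}=1$. In the definition of $\tilde{\mathbf p}_{\hat c}(g)$ the $p_{\mathbf A}$ are likewise probabilities in $[0,1]$. "$\arg\inf$" denotes any minimizer. Moment estimator $\bar c_i(Q',g)$. Let $B_{Q'}(I_{i_1}\wedge\cdots\wedge I_{i_l})$ be the row vector with $\mathbf A$-th entry $\prod_h\xi^{i_h}_{Q'}(\mathbf A)$, $\mathbf A\ne\mathbf 0$. Suppose that for item $i$ there exist items $i_1,\ldots,i_l$ different from $i$ with $$B_{Q'}(I_i\wedge I_{i_1}\wedge\cdots\wedge I_{i_l})=B_{Q'}(I_{i_1}\wedge\cdots\wedge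 I_{i_l}).\qquad( * )$$ Let $\tilde T_{c',g}(Q')=\begin{pmatrix}\mathbf g & T_{c',g}(Q')\\ 1&\mathbb E\end{pmatrix}$ with $\mathbb E=(1,\ldots,1)$, and let $D$ be the matrix, depending only on $g$, with $D\tilde T_{c',g}(Q')=(\mathbf 0,T_{c'-g}(Q'))$ for all $c',Q'$; explicitly, the row of $D$ for a set $U$ of items (the combination of the items in $U$) has, for each nonempty $V\subseteq U$, entry $\prod_{j\in U\setminus V}(-g_j)$ in the position of the combination of the items in $V$, entry $\prod_{j\in U}(-g_j)$ in the last position, and zeros elsewhere. Let $a_g^\top$, $a_{*g}^\top$ be the rows of $D$ for $I_{i_1}\wedge\cdots\wedge I_{i_l}$ and $I_i\wedge I_{i_1}\wedge\cdots\wedge I_{i_l}$ respectively. Then $$\bar c_i(Q',g)=g_i+\frac{a_{*g}^\top\binom{\alpha}{1}}{a_g^\top\binom{\alpha}{1}}$$ (with an arbitrary value if the denominator vanishes). Combined estimator $\hat c(Q',g)$. For each $Q'$, write $c=(c^*,c^{**})$, where $c^*$ collects the coordinates $i$ for which items satisfying $( * )$ exist and $c^{**}$ the remaining coordinates. Let $\bar c^*(Q',g)$ be the vector of the $\bar c_i(Q',g)$ for coordinates in $c^*$, and $\tilde c^{**}(Q',g)=\arg\inf_{c^{**}}S_{(\bar c^*(Q',g),c^{**}),g}(Q')$, with entries of $c^{**}$ in $[0,1]$. Put $\hat c(Q',g)=(\bar c^*(Q',g),\tilde c^{**}(Q',g))$, and then replace each element greater than one by one and each element less than zero by zero, so that $\hat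 c(Q',g)\in[0,1]^m$. $Q\sim Q'$ means that $Q$ and $Q'$ differ by a column permutation. $Q$ is complete if each $e_i^\top$, $i=1,\ldots,k$ (standard basis vectors of $\mathbb R^k$), is a row of $Q$. *)

theory Defs
  imports "HOL-Probability.Probability"
begin

text \<open>
  Items are the elements of a finite type \<open>'m\<close>, attributes those of a finite type \<open>'k\<close>.
  Attribute profiles are of type \<open>bool^'k\<close>, response vectors of type \<open>bool^'m\<close>, and binary
  matrices of size m by k of type \<open>bool^'k^'m\<close>.  A combination of distinct items is represented
  by the set of its items; since T-matrices are saturated throughout, their rows are indexed by all
  nonempty sets of items.
\<close>

definition zero_profile :: "bool^'k" where
  "zero_profile = (\<chi> j. False)"

abbreviation nonzero_profiles :: "(bool^'k) set" where
  "nonzero_profiles \<equiv> {A. A \<noteq> zero_profile}"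

abbreviation combinations :: "'m set set" where
  "combinations \<equiv> {U. U \<noteq> {}}"

definition Q_matrix :: "bool^'k^'m \<Rightarrow> bool" where
  "Q_matrix Q \<longleftrightarrow> (\<forall>i. \<exists>j. Q $ i $ j)"

definition col_equiv :: "bool^'k^'m \<Rightarrow> bool^'k^'m \<Rightarrow> bool" where
  "col_equiv Q Q' \<longleftrightarrow> (\<exists>\<pi>. bij \<pi> \<and> Q' = (\<chi> i j. Q $ i $ \<pi> j))"

definition complete_Q :: "bool^'k^'m \<Rightarrow> bool" where
  "complete_Q Q \<longleftrightarrow> (\<forall>j. \<exists>i. Q $ i = (\<chi> j'. j' = j))"

text \<open>Ideal response; the convention \<open>0^0 = 1\<close> is that of the power operation.\<close>

definition ideal :: "bool^'k^'m \<Rightarrow> 'm \<Rightarrow> bool^'k \<Rightarrow> nat" where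
  "ideal Q i A = (\<Prod>j\<in>UNIV. of_bool (A $ j) ^ of_bool (Q $ i $ j))"

definition T_mat :: "real^'m \<Rightarrow> real^'m \<Rightarrow> bool^'k^'m \<Rightarrow> 'm set \<Rightarrow> bool^'k \<Rightarrow> real" where
  "T_mat c g Q U A = (\<Prod>i\<in>U. g $ i + (c $ i - g $ i) * real (ideal Q i A))"

definition g_vec :: "real^'m \<Rightarrow> 'm set \<Rightarrow> real" where
  "g_vec g U = (\<Prod>i\<in>U. g $ i)"

text \<open>A sample of size N is a list of N response vectors.\<close>

definition alpha_vec :: "(bool^'m) list \<Rightarrow> 'm set \<Rightarrow> real" where
  "alpha_vec xs U = real (card {r. r < length xs \<and> (\<forall>i\<in>U. xs ! r $ i)}) / real (length xs)"

text \<open>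
  A probability vector carries all coordinates, including the one at \<open>zero_profile\<close>;
  the vector \<open>\<^bold>p\<close> multiplied by T is its restriction to \<open>nonzero_profiles\<close>.
\<close>

definition prob_vecs :: "(bool^'k \<Rightarrow> real) set" where
  "prob_vecs = {p. (\<forall>A. p A \<in> {0..1}) \<and> (\<Sum>A\<in>UNIV. p A) = 1}"

definition residual ::
  "real^'m \<Rightarrow> real^'m \<Rightarrow> bool^'k^'m \<Rightarrow> ('m set \<Rightarrow> real) \<Rightarrow> (bool^'k \<Rightarrow> real) \<Rightarrow> real" where
  "residual c g Q \<alpha> p =
     L2_set (\<lambda>U. (\<Sum>A\<in>nonzero_profiles. T_mat c g Q U A * p A)
                   + p zero_profile * g_vec g U - \<alpha> U) combinations"

definition S_fun :: "real^'m \<Rightarrow> real^'m \<Rightarrow> bool^'k^'m \<Rightarrow> ('m set \<Rightarrow> real) \<Rightarrow> real" where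
  "S_fun c g Q \<alpha> = (INF p\<in>prob_vecs. residual c g Q \<alpha> p)"

text \<open>Row of the matrix B for a combination, and condition (*) for an item and a combination.\<close>

definition B_row :: "bool^'k^'m \<Rightarrow> 'm set \<Rightarrow> bool^'k \<Rightarrow> nat" where
  "B_row Q U A = (\<Prod>i\<in>U. ideal Q i A)"

definition star :: "bool^'k^'m \<Rightarrow> 'm \<Rightarrow> 'm set \<Rightarrow> bool" where
  "star Q i U \<longleftrightarrow> U \<noteq> {} \<and> i \<notin> U \<and>
     (\<forall>A\<in>nonzero_profiles. B_row Q (insert i U) A = B_row Q U A)"

definition star_items :: "bool^'k^'m \<Rightarrow> 'm set" where
  "star_items Q = {i. \<exists>U. star Q i U}"

text \<open>
  \<open>D_mat g U V\<close> is the entry of the row of D for \<open>U\<close> in the position of the combination \<open>V\<close>,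
  \<open>D_last g U\<close> its entry in the last position, and \<open>D_times g U x\<close> the product of that row with
  the column \<open>x\<close> extended by a final 1.
\<close>

definition D_mat :: "real^'m \<Rightarrow> 'm set \<Rightarrow> 'm set \<Rightarrow> real" where
  "D_mat g U V = (if V \<noteq> {} \<and> V \<subseteq> U then \<Prod>i\<in>U - V. - g $ i else 0)"

definition D_last :: "real^'m \<Rightarrow> 'm set \<Rightarrow> real" where
  "D_last g U = (\<Prod>i\<in>U. - g $ i)"

definition D_times :: "real^'m \<Rightarrow> 'm set \<Rightarrow> ('m set \<Rightarrow> real) \<Rightarrow> real" where
  "D_times g U x = (\<Sum>V\<in>combinations. D_mat g U V * x V) + D_last g U"

lemma D_times_prod:
  fixes g :: "real^'m" and y :: "'m \<Rightarrow> real"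
  shows "D_times g U (\<lambda>V. \<Prod>i\<in>V. y i) = (\<Prod>i\<in>U. y i - g $ i)"
proof -
  have "(\<Prod>i\<in>U. y i - g $ i) = (\<Prod>i\<in>U. y i + - g $ i)" by simp
  also have "\<dots> = (\<Sum>V\<in>Pow U. (\<Prod>i\<in>V. y i) * (\<Prod>i\<in>U - V. - g $ i))"
    by (rule prod_add) simp
  also have "\<dots> = (\<Sum>V\<in>Pow U - {{}}. (\<Prod>i\<in>V. y i) * (\<Prod>i\<in>U - V. - g $ i)) + D_last g U"
    by (subst sum.remove[where x = "{}"]) (auto simp: D_last_def)
  also have "(\<Sum>V\<in>Pow U - {{}}. (\<Prod>i\<in>V. y i) * (\<Prod>i\<in>U - V. - g $ i))
      = (\<Sum>V\<in>combinations. D_mat g U V * (\<Prod>i\<in>V. y i))"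
    by (rule sum.mono_neutral_cong_left) (auto simp: D_mat_def)
  finally show ?thesis by (simp add: D_times_def)
qed

text \<open>The two parts of the identity that characterizes D.\<close>

lemma D_times_T_mat: "D_times g U (\<lambda>V. T_mat c g Q V A) = T_mat (c - g) 0 Q U A"
  by (simp add: T_mat_def D_times_prod)

lemma D_times_g_vec: "U \<noteq> {} \<Longrightarrow> D_times g U (g_vec g) = 0"
  using D_times_prod[of g U "\<lambda>i. g $ i"] by (simp add: g_vec_def[abs_def] card_gt_0_iff)

text \<open>
  \<open>moment_estimate g Q W \<alpha> cbar\<close>: \<open>cbar\<close> carries moment estimates at the items of
  \<open>star_items Q\<close>, where \<open>W i\<close> is the combination used for item \<open>i\<close>.  The value is arbitrary
  where the denominator vanishes.
\<close>

definition moment_estimate ::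
  "real^'m \<Rightarrow> bool^'k^'m \<Rightarrow> ('m \<Rightarrow> 'm set) \<Rightarrow> ('m set \<Rightarrow> real) \<Rightarrow> real^'m \<Rightarrow> bool" where
  "moment_estimate g Q W \<alpha> cbar \<longleftrightarrow>
     (\<forall>i\<in>star_items Q. D_times g (W i) \<alpha> \<noteq> 0 \<longrightarrow>
        cbar $ i = g $ i + D_times g (insert i (W i)) \<alpha> / D_times g (W i) \<alpha>)"

text \<open>
  The vector \<open>v\<close> below is the combined estimate before truncation: it agrees with the moment
  estimates \<open>cbar\<close> on \<open>star_items Q\<close> and minimizes S over the remaining coordinates.
\<close>

definition combined_estimate ::
  "real^'m \<Rightarrow> bool^'k^'m \<Rightarrow> ('m \<Rightarrow> 'm set) \<Rightarrow> ('m set \<Rightarrow> real) \<Rightarrow> real^'m \<Rightarrow> bool" where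
  "combined_estimate g Q W \<alpha> chat \<longleftrightarrow>
     (\<exists>cbar v. moment_estimate g Q W \<alpha> cbar \<and>
        is_arg_min (\<lambda>c'. S_fun c' g Q \<alpha>)
          (\<lambda>c'. (\<forall>i\<in>star_items Q. c' $ i = cbar $ i) \<and> (\<forall>i. i \<notin> star_items Q \<longrightarrow> c' $ i \<in> {0..1})) v \<and>
        chat = (\<chi> i. max 0 (min 1 (v $ i))))"

definition sample :: "(nat \<Rightarrow> 'w \<Rightarrow> bool^'m) \<Rightarrow> nat \<Rightarrow> 'w \<Rightarrow> (bool^'m) list" where
  "sample R N \<omega> = map (\<lambda>r. R r \<omega>) [0..<N]"

definition consistent_estimator ::
  "'w measure \<Rightarrow> (nat \<Rightarrow> 'w \<Rightarrow> bool^'m) \<Rightarrow> ((bool^'m) list \<Rightarrow> real^'m) \<Rightarrow> real^'m \<Rightarrow> bool" where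
  "consistent_estimator M R est c \<longleftrightarrow>
     (\<forall>\<epsilon>>0. (\<lambda>N. \<P>(\<omega> in M. norm (est (sample R N \<omega>) - c) \<le> \<epsilon>)) \<longlonglongrightarrow> 1)"

text \<open>
  The data generating model.  \<open>A r\<close> and \<open>R r\<close> are the attribute profile and the response vector of
  subject \<open>r\<close>.  Given the vector of ideal responses of a subject, its responses are jointly
  independent, the response to item \<open>i\<close> being positive with probability \<open>c\<^sub>i\<close> or \<open>g\<^sub>i\<close>.
\<close>

definition ideal_vec :: "bool^'k^'m \<Rightarrow> bool^'k \<Rightarrow> nat^'m" where
  "ideal_vec Q A = (\<chi> i. ideal Q i A)"

definition iid_profiles ::
  "'w measure \<Rightarrow> (nat \<Rightarrow> 'w \<Rightarrow> bool^'k) \<Rightarrow> (bool^'k \<Rightarrow> real) \<Rightarrow> bool" where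
  "iid_profiles M A pstar \<longleftrightarrow>
     prob_space.indep_vars M (\<lambda>_. count_space UNIV) A UNIV \<and>
     (\<forall>r a. \<P>(\<omega> in M. A r \<omega> = a) = pstar a)"

definition independent_subjects ::
  "'w measure \<Rightarrow> (nat \<Rightarrow> 'w \<Rightarrow> bool^'k) \<Rightarrow> (nat \<Rightarrow> 'w \<Rightarrow> bool^'m) \<Rightarrow> bool" where
  "independent_subjects M A R \<longleftrightarrow>
     prob_space.indep_vars M (\<lambda>_. count_space UNIV) (\<lambda>r \<omega>. (A r \<omega>, R r \<omega>)) UNIV"

definition response_model ::
  "'w measure \<Rightarrow> bool^'k^'m \<Rightarrow> real^'m \<Rightarrow> real^'m \<Rightarrow>
   (nat \<Rightarrow> 'w \<Rightarrow> bool^'k) \<Rightarrow> (nat \<Rightarrow> 'w \<Rightarrow> bool^'m) \<Rightarrow> bool" where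
  "response_model M Q c g A R \<longleftrightarrow>
     (\<forall>r z. 0 < \<P>(\<omega> in M. ideal_vec Q (A r \<omega>) = z) \<longrightarrow>
        (\<forall>x. \<P>(\<omega> in M. R r \<omega> = x \<bar> ideal_vec Q (A r \<omega>) = z)
              = (\<Prod>i\<in>UNIV. \<P>(\<omega> in M. R r \<omega> $ i = x $ i \<bar> ideal_vec Q (A r \<omega>) = z))) \<and>
        (\<forall>i. \<P>(\<omega> in M. R r \<omega> $ i \<bar> ideal_vec Q (A r \<omega>) = z)
              = c $ i ^ (z $ i) * g $ i ^ (1 - z $ i)))"

end

theory Submission
  imports Defs
begin

text \<open>
  The argument separates a deterministic statement about moments from a law of large numbers.

  The vector \<open>\<alpha>\<close> converges in probability to the vector of true moments, by Hoeffding's inequality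
  for each combination of items (\<open>positive_responses_prob\<close>, \<open>prob_near_moments_tendsto_1\<close>).  It
  therefore suffices that the estimates are right for all vectors of moments near the true one.

  The essential point is identifiability (\<open>identifiable\<close>): if some candidate matrix \<open>Q'\<close>, some
  vector \<open>c'\<close> whatsoever and some probability vector \<open>p'\<close> reproduce the true moments, then
  \<open>Q'\<close> is \<open>Q\<close> up to a permutation of columns, and \<open>p' = p\<close> if \<open>Q' = Q\<close>.  The matrix
  D turns the moment equations into equations between products of slopes \<open>c\<^sub>i - g\<^sub>i\<close> and
  probabilities of possessing all attributes required by a set of items.  Adding an item to a set
  never increases such a probability, and leaves it unchanged exactly when the item requires nothing
  new, because all profiles have positive probability.  Since each attribute is required twice, each
  item of \<open>Q\<close> is covered by the others; comparing the two models along an item covered under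
  \<open>Q'\<close> shows that its slopes agree and that the covering relation passes from \<open>Q'\<close> to \<open>Q\<close>
  (\<open>covered_item\<close>).  The single-attribute items of the complete matrix \<open>Q\<close> are not covered by
  each other, hence they are not under \<open>Q'\<close>, and counting attributes shows that they have one
  attribute each there.  This fixes the permutation, and the remaining items follow.

  By compactness of the parameter space, identifiability gives a positive lower bound for the
  residuals of all wrong matrices, uniformly in \<open>c'\<close>, and likewise for the residuals of \<open>Q\<close> at
  profile weights away from the true ones (\<open>residual_bounded_away\<close>).  On the other hand all items
  of \<open>Q\<close> admit moment estimates, which are continuous at the true moments, so the combined estimate
  for \<open>Q\<close> tends to \<open>c\<close> and its minimal residual to zero (\<open>true_matrix_fits\<close>).  Minimizers
  of the residual are therefore eventually correct.
\<close>

section \<open>Moments of the model\<close>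

text \<open>The attributes that are needed for answering all items of a set.\<close>

definition required :: "bool^'k^'m \<Rightarrow> 'm set \<Rightarrow> 'k set" where
  "required Q U = {j. \<exists>i\<in>U. Q $ i $ j}"

text \<open>The probability that a profile with distribution \<open>p\<close> possesses all attributes of \<open>S\<close>.\<close>

definition mastery :: "(bool^'k \<Rightarrow> real) \<Rightarrow> 'k set \<Rightarrow> real" where
  "mastery p S = (\<Sum>A | S \<subseteq> {j. A $ j}. p A)"

text \<open>
  The vector that the residual compares with the data, written as one sum over all profiles: for a
  matrix without zero rows the column of T at \<open>zero_profile\<close> is \<open>g_vec\<close>.  It is the vector of
  probabilities of positive responses to all items of \<open>U\<close>.
\<close>

definition moments :: "real^'m \<Rightarrow> real^'m \<Rightarrow> bool^'k^'m \<Rightarrow> (bool^'k \<Rightarrow> real) \<Rightarrow> 'm set \<Rightarrow> real" where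
  "moments c g Q p U = (\<Sum>A\<in>UNIV. T_mat c g Q U A * p A)"

lemma prod_of_bool:
  assumes "finite S"
  shows "(\<Prod>x\<in>S. of_bool (P x)) = (of_bool (\<forall>x\<in>S. P x) :: 'a :: comm_semiring_1)"
  using assms by (induction S rule: finite_induct) auto

lemma ideal_eq: "ideal Q i A = of_bool (required Q {i} \<subseteq> {j. A $ j})"
proof -
  have "of_bool (A $ j) ^ of_bool (Q $ i $ j) = (of_bool (Q $ i $ j \<longrightarrow> A $ j) :: nat)" for j
    by auto
  then show ?thesis
    by (simp add: ideal_def prod_of_bool required_def subset_eq)
qed

lemma required_insert: "required Q (insert i U) = required Q {i} \<union> required Q U"
  by (auto simp: required_def)

lemma required_subset_iff: "required Q U \<subseteq> S \<longleftrightarrow> (\<forall>i\<in>U. required Q {i} \<subseteq> S)"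
  by (auto simp: required_def)

lemma required_mono: "U \<subseteq> V \<Longrightarrow> required Q U \<subseteq> required Q V"
  by (auto simp: required_def)

lemma required_Union: "required Q U = (\<Union>i\<in>U. required Q {i})"
  by (auto simp: required_def)

lemma T_mat_zero_guess:
  "T_mat d 0 Q U A = (\<Prod>i\<in>U. d $ i) * of_bool (required Q U \<subseteq> {j. A $ j})"
  by (simp add: T_mat_def ideal_eq prod.distrib prod_of_bool required_subset_iff[of Q U])

lemma B_row_eq: "B_row Q U A = of_bool (required Q U \<subseteq> {j. A $ j})"
  by (simp add: B_row_def ideal_eq prod_of_bool required_subset_iff[of Q U])

lemma sum_T_mat_zero_guess:
  "(\<Sum>A\<in>UNIV. T_mat d 0 Q U A * p A) = (\<Prod>i\<in>U. d $ i) * mastery p (required Q U)"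
  unfolding mastery_def T_mat_zero_guess sum_distrib_left
  by (rule sum.mono_neutral_cong_right) auto

lemma T_mat_zero_profile:
  assumes "Q_matrix Q"
  shows "T_mat c g Q U zero_profile = g_vec g U"
proof -
  have "ideal Q i zero_profile = 0" for i
    using assms by (auto simp: ideal_eq zero_profile_def required_def Q_matrix_def)
  then show ?thesis
    by (simp add: T_mat_def g_vec_def)
qed

lemma residual_eq_moments:
  assumes "Q_matrix Q"
  shows "residual c g Q \<alpha> p = L2_set (\<lambda>U. moments c g Q p U - \<alpha> U) combinations"
proof -
  have "moments c g Q p U
      = (\<Sum>A\<in>nonzero_profiles. T_mat c g Q U A * p A) + p zero_profile * g_vec g U" for U
  proof -
    have "UNIV - {zero_profile} = (nonzero_profiles :: (bool^'a) set)" by auto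
    then show ?thesis
      unfolding moments_def
      by (subst sum.remove[where x = zero_profile]) (auto simp: T_mat_zero_profile[OF assms])
  qed
  then show ?thesis
    by (simp add: residual_def)
qed

text \<open>
  The matrix D removes the guessing: it turns the moments into products of slopes
  \<open>c\<^sub>i - g\<^sub>i\<close> and mastery probabilities.
\<close>

lemma D_times_moments:
  assumes "(\<Sum>A\<in>UNIV. p A) = 1"
  shows "D_times g U (moments c g Q p) = (\<Prod>i\<in>U. c $ i - g $ i) * mastery p (required Q U)"
proof -
  have "D_times g U (moments c g Q p)
      = (\<Sum>A\<in>UNIV. \<Sum>V\<in>combinations. D_mat g U V * T_mat c g Q V A * p A) + D_last g U * (\<Sum>A\<in>UNIV. p A)"
    unfolding D_times_def moments_def sum_distrib_left assms
    by (subst sum.swap) (simp add: mult.assoc)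
  also have "\<dots> = (\<Sum>A\<in>UNIV. D_times g U (\<lambda>V. T_mat c g Q V A) * p A)"
    by (simp add: D_times_def sum.distrib sum_distrib_left sum_distrib_right ring_distribs)
  also have "\<dots> = (\<Sum>A\<in>UNIV. T_mat (c - g) 0 Q U A * p A)"
    by (simp add: D_times_T_mat)
  finally show ?thesis
    by (simp add: sum_T_mat_zero_guess)
qed

lemma D_times_cong: "(\<And>V. V \<noteq> {} \<Longrightarrow> x V = y V) \<Longrightarrow> D_times g U x = D_times g U y"
  by (simp add: D_times_def)

lemma mastery_antimono:
  assumes "\<And>A. p A \<ge> 0" "S \<subseteq> T"
  shows "mastery p T \<le> mastery p S"
  unfolding mastery_def using assms by (intro sum_mono2) auto

lemma mastery_pos:
  assumes "\<And>A. p A > 0"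
  shows "mastery p S > 0"
  unfolding mastery_def using assms
  by (intro sum_pos2[where i = "\<chi> j. True"]) (auto simp: less_imp_le)

text \<open>
  Full support enters here: the profile that has exactly the attributes of \<open>S\<close> is counted in
  \<open>mastery p S\<close>, and in \<open>mastery p (S \<union> T)\<close> only if \<open>T\<close> is contained in \<open>S\<close>.
\<close>

lemma mastery_Un_eq_imp_subset:
  assumes pos: "\<And>A. p A > 0" and eq: "mastery p (S \<union> T) = mastery p S"
  shows "T \<subseteq> S"
proof (rule ccontr)
  let ?A = "\<chi> j. j \<in> S"
  assume "\<not> T \<subseteq> S"
  then have "mastery p (S \<union> T) < mastery p S"
    unfolding mastery_def
    by (intro sum_strict_mono2[where b = ?A]) (use pos in \<open>auto simp: less_imp_le\<close>)
  with eq show False by simp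
qed

text \<open>
  Moebius inversion over the lattice of profiles, as an induction from the full profile downwards.
\<close>

lemma mastery_inject:
  fixes p p' :: "bool^'k \<Rightarrow> real"
  assumes "\<And>S. mastery p S = mastery p' S"
  shows "p = p'"
proof
  fix A :: "bool^'k"
  show "p A = p' A"
  proof (induction "card {j. \<not> A $ j}" arbitrary: A rule: less_induct)
    case less
    let ?up = "{B. {j. A $ j} \<subseteq> {j. B $ j}}"
    have "p B = p' B" if "B \<in> ?up - {A}" for B
    proof (rule less)
      have "{j. \<not> B $ j} \<subset> {j. \<not> A $ j}"
        using that by (auto simp: vec_eq_iff)
      then show "card {j. \<not> B $ j} < card {j. \<not> A $ j}"
        by (intro psubset_card_mono) auto
    qed
    then have "(\<Sum>B\<in>?up - {A}. p B) = (\<Sum>B\<in>?up - {A}. p' B)"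
      by (intro sum.cong) auto
    moreover have "p A + (\<Sum>B\<in>?up - {A}. p B) = p' A + (\<Sum>B\<in>?up - {A}. p' B)"
      using assms[of "{j. A $ j}"] unfolding mastery_def
      by (simp add: sum.remove[where x = A and A = ?up])
    ultimately show ?case by simp
  qed
qed

section \<open>Identifiability\<close>

text \<open>
  In this and the following statements, two models with slopes \<open>d\<close>, \<open>d'\<close>, profile weights
  \<open>p\<close>, \<open>p'\<close> and matrices \<open>Q\<close>, \<open>Q'\<close> have the same moments after multiplication with
  D; only the unprimed one is known to have nonzero slopes and full support.  Dividing the equation
  for \<open>insert i U\<close> by the one for \<open>U\<close> isolates the slopes of item \<open>i\<close>.
\<close>

lemma ratio_identity:
  fixes d d' :: "real^'m"
  assumes pos: "\<And>A. p A > 0"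
    and eq: "\<And>U. (\<Prod>i\<in>U. d' $ i) * mastery p' (required Q' U) = (\<Prod>i\<in>U. d $ i) * mastery p (required Q U)"
    and d: "\<And>i. d $ i \<noteq> 0" and "i \<notin> U"
  shows "d' $ i * mastery p' (required Q' (insert i U)) * mastery p (required Q U)
       = d $ i * mastery p (required Q (insert i U)) * mastery p' (required Q' U)"
proof -
  have ne: "(\<Prod>i\<in>U. d $ i) * mastery p (required Q U) \<noteq> 0"
    using d mastery_pos[of p, OF pos, of "required Q U"] by simp
  let ?a = "\<Prod>i\<in>U. d' $ i" and ?b = "\<Prod>i\<in>U. d $ i"
  have "?a \<noteq> 0" "?b \<noteq> 0"
    using ne unfolding eq[of U, symmetric] by (simp_all only: mult_eq_0_iff de_Morgan_disj) (use d in auto)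
  have 1: "d' $ i * ?a * mastery p' (required Q' (insert i U)) = d $ i * ?b * mastery p (required Q (insert i U))"
    using eq[of "insert i U"] \<open>i \<notin> U\<close> by simp
  have "?a * ?b * (d' $ i * mastery p' (required Q' (insert i U)) * mastery p (required Q U))
      = (d' $ i * ?a * mastery p' (required Q' (insert i U))) * (?b * mastery p (required Q U))"
    by (simp add: mult_ac)
  also have "\<dots> = (d $ i * ?b * mastery p (required Q (insert i U))) * (?a * mastery p' (required Q' U))"
    by (simp only: 1 eq)
  also have "\<dots> = ?a * ?b * (d $ i * mastery p (required Q (insert i U)) * mastery p' (required Q' U))"
    by (simp add: mult_ac)
  finally show ?thesis
    using \<open>?a \<noteq> 0\<close> \<open>?b \<noteq> 0\<close> by simp
qed

lemma mastery_pos_from_moments: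
  fixes d d' :: "real^'m"
  assumes pos: "\<And>A. p A > 0" and pos': "\<And>A. p' A \<ge> 0"
    and eq: "\<And>U. (\<Prod>i\<in>U. d' $ i) * mastery p' (required Q' U) = (\<Prod>i\<in>U. d $ i) * mastery p (required Q U)"
    and d: "\<And>i. d $ i \<noteq> 0"
  shows "mastery p' (required Q' U) > 0"
proof -
  have "(\<Prod>i\<in>U. d $ i) * mastery p (required Q U) \<noteq> 0"
    using d mastery_pos[of p, OF pos, of "required Q U"] by simp
  then have "mastery p' (required Q' U) \<noteq> 0"
    using eq[of U] by auto
  moreover have "mastery p' (required Q' U) \<ge> 0"
    unfolding mastery_def by (intro sum_nonneg) (use pos' in auto)
  ultimately show ?thesis by simp
qed

lemma covered_by_others:
  assumes two: "\<And>j. card {i. Q $ i $ j} \<ge> 2"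
  shows "required Q {i} \<subseteq> required Q (UNIV - {i})"
proof
  fix j assume j: "j \<in> required Q {i}"
  have "\<exists>i'. i' \<noteq> i \<and> Q $ i' $ j"
  proof (rule ccontr)
    assume "\<nexists>i'. i' \<noteq> i \<and> Q $ i' $ j"
    then have "card {i'. Q $ i' $ j} \<le> card {i}"
      by (intro card_mono) auto
    with two[of j] show False by simp
  qed
  then show "j \<in> required Q (UNIV - {i})"
    by (auto simp: required_def)
qed

text \<open>
  The key comparison.  If under \<open>Q'\<close> the items of \<open>U\<close> already require all attributes of \<open>i\<close>,
  then adding \<open>i\<close> to \<open>U\<close> multiplies the moment of the primed model by \<open>d' $ i\<close> and that of the
  other model by at most \<open>d $ i\<close> in absolute value; so \<open>\<bar>d' $ i\<bar> \<le> \<bar>d $ i\<bar>\<close>.  Under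
  \<open>Q\<close> the items other than \<open>i\<close> require all attributes of \<open>i\<close>, which gives the reverse
  inequality.  Hence the slopes agree and nothing is lost in the first comparison, and full support
  forces the inclusion under \<open>Q\<close>.
\<close>

lemma covered_item:
  fixes d d' :: "real^'m"
  assumes two: "\<And>j. card {i. Q $ i $ j} \<ge> 2"
    and pos: "\<And>A. p A > 0" and pos': "\<And>A. p' A \<ge> 0"
    and eq: "\<And>U. (\<Prod>i\<in>U. d' $ i) * mastery p' (required Q' U) = (\<Prod>i\<in>U. d $ i) * mastery p (required Q U)"
    and d: "\<And>i. d $ i \<noteq> 0"
    and i: "i \<notin> U" and covered: "required Q' {i} \<subseteq> required Q' U"
  shows "d' $ i = d $ i" and "required Q {i} \<subseteq> required Q U"
proof -
  let ?M = "\<lambda>U. mastery p (required Q U)" and ?M' = "\<lambda>U. mastery p' (required Q' U)"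
  note ratio = ratio_identity[where p = p and p' = p' and d = d and d' = d' and Q = Q and Q' = Q', OF pos eq d]
  have M: "?M V > 0" for V by (rule mastery_pos[OF pos])
  have M': "?M' V > 0" for V by (rule mastery_pos_from_moments[where p = p and d = d and d' = d' and Q = Q, OF pos pos' eq d])
  have mono: "?M (insert i V) \<le> ?M V" for V
    by (intro mastery_antimono less_imp_le[OF pos] required_mono) auto
  have mono': "?M' (insert i V) \<le> ?M' V" for V
    by (intro mastery_antimono pos' required_mono) auto
  have "required Q' (insert i U) = required Q' U"
    using covered required_insert[of Q' i U] by auto
  then have up: "d' $ i * ?M U = d $ i * ?M (insert i U)"
    using ratio[OF i] M'[of U] by (simp add: mult_ac)
  define V where "V = UNIV - {i}"
  have "required Q (insert i V) = required Q V"
    using covered_by_others[where Q = Q and i = i, OF two] required_insert[of Q i V] by (auto simp: V_def)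
  then have low: "d' $ i * ?M' (insert i V) = d $ i * ?M' V"
    using ratio[of i V] M[of V] by (simp add: mult_ac V_def)
  have "\<bar>d' $ i\<bar> * ?M U = \<bar>d $ i\<bar> * ?M (insert i U)"
    using arg_cong[OF up, of abs] M[of U] M[of "insert i U"] by (simp add: abs_mult)
  also have "\<dots> \<le> \<bar>d $ i\<bar> * ?M U"
    using mono by (intro mult_left_mono) auto
  finally have le: "\<bar>d' $ i\<bar> \<le> \<bar>d $ i\<bar>"
    using M[of U] by simp
  have "\<bar>d $ i\<bar> * ?M' V = \<bar>d' $ i\<bar> * ?M' (insert i V)"
    using arg_cong[OF low, of abs] M'[of V] M'[of "insert i V"] by (simp add: abs_mult)
  also have "\<dots> \<le> \<bar>d' $ i\<bar> * ?M' V"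
    using mono' by (intro mult_left_mono) auto
  finally have "\<bar>d $ i\<bar> \<le> \<bar>d' $ i\<bar>"
    using M'[of V] by simp
  with le have abs: "\<bar>d' $ i\<bar> = \<bar>d $ i\<bar>" by simp
  with \<open>\<bar>d' $ i\<bar> * ?M U = \<bar>d $ i\<bar> * ?M (insert i U)\<close> d[of i]
  have M_eq: "?M (insert i U) = ?M U" by simp
  with up M[of U] show "d' $ i = d $ i" by simp
  have "mastery p (required Q U \<union> required Q {i}) = mastery p (required Q U)"
    using M_eq required_insert[of Q i U] by (simp add: Un_commute)
  then show "required Q {i} \<subseteq> required Q U"
    using mastery_Un_eq_imp_subset[of p, OF pos] by blast
qed

text \<open>
  The single-attribute items \<open>f j\<close> of the complete matrix \<open>Q\<close> are not covered by each other, so by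
  \<open>covered_item\<close> they are not covered by each other under \<open>Q'\<close> either.  Each of them therefore
  has a private attribute \<open>h j\<close> among them under \<open>Q'\<close>, and since there are only as many attributes
  as such items, \<open>h\<close> is a permutation and \<open>Q'\<close> requires just \<open>h j\<close> for \<open>f j\<close>.
\<close>

theorem identifiable_mastery:
  fixes Q Q' :: "bool^'k^'m" and d d' :: "real^'m"
  assumes compl: "complete_Q Q" and two: "\<And>j. card {i. Q $ i $ j} \<ge> 2"
    and pos: "\<And>A. p A > 0" and pos': "\<And>A. p' A \<ge> 0"
    and eq: "\<And>U. (\<Prod>i\<in>U. d' $ i) * mastery p' (required Q' U) = (\<Prod>i\<in>U. d $ i) * mastery p (required Q U)"
    and d: "\<And>i. d $ i \<noteq> 0"
  shows "d' = d" and "col_equiv Q' Q"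
proof -
  note covered = covered_item[where Q = Q and Q' = Q' and p = p and p' = p' and d = d and d' = d',
      OF two pos pos' eq d]
  obtain f where f: "\<And>j. Q $ (f j) = (\<chi> j'. j' = j)"
    using compl unfolding complete_Q_def by metis
  have req_f: "required Q {f j} = {j}" for j
    by (auto simp: required_def f)
  have req_f_image: "required Q (f ` S) = S" for S
    by (auto simp: required_def f)
  have inj_f: "inj f"
    using req_f by (metis injI singleton_inject)
  have "\<exists>x. x \<in> required Q' {f j} \<and> x \<notin> required Q' (f ` (UNIV - {j}))" for j
  proof (rule ccontr)
    assume "\<not> ?thesis"
    then have "required Q' {f j} \<subseteq> required Q' (f ` (UNIV - {j}))" by auto
    moreover have "f j \<notin> f ` (UNIV - {j})"
      using inj_f by (auto simp: inj_def)
    ultimately have "{j} \<subseteq> UNIV - {j}"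
      using covered(2) by (metis req_f req_f_image)
    then show False by simp
  qed
  then obtain h where h: "\<And>j. h j \<in> required Q' {f j}"
      and h_private: "\<And>j. h j \<notin> required Q' (f ` (UNIV - {j}))"
    by metis
  have h_only: "j' = j" if "h j' \<in> required Q' {f j}" for j j'
    using that h_private[of j'] by (auto simp: required_def)
  have "inj h"
    using h h_only by (metis injI)
  then have "bij h"
    by (simp add: bij_def finite_UNIV_inj_surj)
  have req'_f: "required Q' {f j} = {h j}" for j
  proof (intro subset_antisym subsetI)
    fix x assume "x \<in> required Q' {f j}"
    moreover obtain j' where "x = h j'"
      using \<open>bij h\<close> by (metis bij_pointE)
    ultimately show "x \<in> {h j}"
      using h_only by blast
  qed (use h in auto)
  have req'_f_image: "required Q' (f ` S) = h ` S" for S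
    by (subst required_Union) (auto simp: req'_f)
  have vimage: "\<exists>S. required Q' {i} = h ` S" for i
    using \<open>bij h\<close> by (metis bij_is_surj surj_image_vimage_eq)
  \<comment> \<open>An item outside the range of f is covered under Q' by the single-attribute items that
      belong to its attributes.\<close>
  have other: "d' $ i = d $ i \<and> h ` required Q {i} \<subseteq> required Q' {i}" if "i \<notin> range f" for i
  proof -
    obtain S where S: "required Q' {i} = h ` S" using vimage by blast
    have "i \<notin> f ` S" using that by auto
    moreover have "required Q' {i} \<subseteq> required Q' (f ` S)"
      by (simp add: S req'_f_image)
    ultimately have "d' $ i = d $ i" "required Q {i} \<subseteq> S"
      using covered by (metis req_f_image)+
    then show ?thesis by (auto simp: S)
  qed
  \<comment> \<open>The second item requiring attribute j lies outside the range of f and covers f j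
      under Q'.\<close>
  have d_f: "d' $ (f j) = d $ (f j)" for j
  proof -
    have "j \<in> required Q (UNIV - {f j})"
      using covered_by_others[OF two, where i = "f j"] req_f by auto
    then obtain i where i: "i \<noteq> f j" "j \<in> required Q {i}"
      by (auto simp: required_def)
    then have "i \<notin> range f"
      using req_f by auto
    with other i have "h j \<in> required Q' {i}" by blast
    then show ?thesis
      using i by (intro covered(1)[where U = "{i}"]) (auto simp: req'_f)
  qed
  have d_eq: "d' $ i = d $ i" for i
    using other[of i] d_f by (cases "i \<in> range f") auto
  then show "d' = d"
    by (simp add: vec_eq_iff)
  have M_eq: "mastery p' (required Q' U) = mastery p (required Q U)" for U
    using eq[of U] d by (simp add: d_eq)
  have req': "required Q' {i} = h ` required Q {i}" for i
  proof (cases "i \<in> range f")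
    case True
    then show ?thesis by (auto simp: req_f req'_f)
  next
    case False
    obtain S where S: "required Q' {i} = h ` S" using vimage by blast
    have sub: "required Q {i} \<subseteq> S"
      using other[OF False] \<open>inj h\<close> by (auto simp: S inj_image_subset_iff)
    \<comment> \<open>Conversely, adding i to the single-attribute items of its own attributes does not
        change the moment under Q, hence not under Q', where it would add the attributes h ` S.\<close>
    let ?U = "f ` required Q {i}"
    have "mastery p S = mastery p' (h ` S)"
      using M_eq[of "f ` S"] by (simp add: req_f_image req'_f_image)
    also have "h ` S = required Q' (insert i ?U)"
      using sub by (subst required_insert) (auto simp: S req'_f_image)
    also have "mastery p' \<dots> = mastery p (required Q {i})"
      using required_insert[of Q i ?U] by (simp add: M_eq req_f_image)
    finally have "mastery p (required Q {i} \<union> S) = mastery p (required Q {i})"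
      using sub by (simp add: Un_absorb1)
    then have "S \<subseteq> required Q {i}"
      by (rule mastery_Un_eq_imp_subset[OF pos])
    with sub S show ?thesis by auto
  qed
  have "Q' $ i $ h j = Q $ i $ j" for i j
    using req'[of i] \<open>inj h\<close> by (auto simp: required_def set_eq_iff inj_image_mem_iff dest: injD)
  then show "col_equiv Q' Q"
    unfolding col_equiv_def using \<open>bij h\<close> by (intro exI[of _ h]) (simp add: vec_eq_iff)
qed

text \<open>
  No restriction on the real vector \<open>c'\<close> is needed, so the result covers every value that an
  estimator of \<open>c\<close> may take.
\<close>

theorem identifiable:
  fixes Q Q' :: "bool^'k^'m"
  assumes compl: "complete_Q Q" and two: "\<And>j. card {i. Q $ i $ j} \<ge> 2"
    and pos: "\<And>A. p A > 0" and p: "p \<in> prob_vecs" and p': "p' \<in> prob_vecs"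
    and cg: "\<And>i. c $ i \<noteq> g $ i"
    and eq: "\<And>U. U \<noteq> {} \<Longrightarrow> moments c' g Q' p' U = moments c g Q p U"
  shows "col_equiv Q' Q" and "Q' = Q \<Longrightarrow> p' = p"
proof -
  have s: "(\<Sum>A\<in>UNIV. p A) = 1" "(\<Sum>A\<in>UNIV. p' A) = 1"
    using p p' by (auto simp: prob_vecs_def)
  have pos': "p' A \<ge> 0" for A
    using p' by (auto simp: prob_vecs_def)
  have eq': "(\<Prod>i\<in>U. (c' - g) $ i) * mastery p' (required Q' U)
      = (\<Prod>i\<in>U. (c - g) $ i) * mastery p (required Q U)" for U
    using D_times_moments[OF s(1), of g U c Q] D_times_moments[OF s(2), of g U c' Q']
      D_times_cong[OF eq, where g = g and U = U] by simp
  have d: "(c - g) $ i \<noteq> 0" for i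
    using cg[of i] by simp
  note ident = identifiable_mastery[OF compl two pos pos' eq' d]
  show "col_equiv Q' Q"
    by (rule ident(2))
  show "p' = p" if "Q' = Q"
  proof (rule mastery_inject)
    fix S :: "'k set"
    obtain f where f: "\<And>j. Q $ (f j) = (\<chi> j'. j' = j)"
      using compl unfolding complete_Q_def by metis
    then have "required Q (f ` S) = S"
      by (auto simp: required_def)
    then show "mastery p' S = mastery p S"
      using eq'[of "f ` S"] ident(1) that d by simp
  qed
qed

section \<open>Stability under perturbation of the moments\<close>

lemma residual_nonneg: "residual c g Q \<alpha> p \<ge> 0"
  by (simp add: residual_def)

lemma residual_perturb:
  fixes x y :: "real^('m::finite set)" and Q :: "bool^'k^'m"
  shows "residual c g Q (($) x) p \<le> residual c g Q (($) y) p + dist x y"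
proof -
  let ?f = "\<lambda>U. (\<Sum>A\<in>nonzero_profiles. T_mat c g Q U A * p A) + p zero_profile * g_vec g U"
  have "residual c g Q (($) x) p = L2_set (\<lambda>U. (?f U - y $ U) + (y $ U - x $ U)) combinations"
    unfolding residual_def by (rule L2_set_cong) auto
  also have "\<dots> \<le> residual c g Q (($) y) p + L2_set (\<lambda>U. y $ U - x $ U) combinations"
    unfolding residual_def by (rule L2_set_triangle_ineq)
  also have "L2_set (\<lambda>U. y $ U - x $ U) combinations \<le> dist x y"
    unfolding dist_vec_def L2_set_def dist_real_def
    by (auto intro!: real_sqrt_le_mono sum_mono2 simp: power2_commute)
  finally show ?thesis by simp
qed

text \<open>
  Probability vectors are represented as elements of a Euclidean space, so that compactness is
  available.
\<close>

lemma compact_parameters: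
  "compact {(c' :: real^'m, v :: real^(bool^'k)). (\<forall>i. c' $ i \<in> {0..1 :: real}) \<and> ($) v \<in> prob_vecs}"
proof -
  have "closed {v :: real^(bool^'k). ($) v \<in> prob_vecs}"
    unfolding prob_vecs_def atLeastAtMost_iff mem_Collect_eq
    by (intro closed_Collect_conj closed_Collect_all closed_Collect_le closed_Collect_eq continuous_intros)
  moreover have "{v :: real^(bool^'k). ($) v \<in> prob_vecs} \<subseteq> cbox 0 1"
    by (auto simp: prob_vecs_def mem_box_cart)
  ultimately have "compact {v :: real^(bool^'k). ($) v \<in> prob_vecs}"
    by (meson bounded_cbox bounded_subset compact_eq_bounded_closed)
  moreover have "{(c' :: real^'m, v :: real^(bool^'k)). (\<forall>i. c' $ i \<in> {0..1 :: real}) \<and> ($) v \<in> prob_vecs}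
      = cbox 0 1 \<times> {v. ($) v \<in> prob_vecs}"
    by (auto simp: mem_box_cart)
  ultimately show ?thesis
    by (simp add: compact_Times)
qed

text \<open>
  The filter statement concerns vectors of moments, indexed by all sets of items; the coordinate at
  the empty set does not affect the residual.
\<close>

lemma residual_bounded_away:
  fixes y :: "real^('m::finite set)" and Q' :: "bool^'k^'m"
  assumes "closed C"
    and C: "C \<subseteq> {(c', v). (\<forall>i. c' $ i \<in> {0..1}) \<and> ($) v \<in> prob_vecs}"
    and nz: "\<And>c' v. (c', v) \<in> C \<Longrightarrow> residual c' g Q' (($) y) (($) v) \<noteq> 0"
  shows "\<exists>\<delta>>0. \<forall>\<^sub>F x in nhds y. \<forall>(c', v)\<in>C. \<delta> \<le> residual c' g Q' (($) x) (($) v)"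
proof -
  let ?r = "\<lambda>x z. residual (fst z) g Q' (($) x) (($) (snd z))"
  obtain \<delta> where \<delta>: "\<delta> > 0" "\<forall>z\<in>C. \<delta> \<le> ?r y z"
  proof (cases "C = {}")
    case True
    then show ?thesis using that[of 1] by auto
  next
    case False
    have "C = C \<inter> {(c', v). (\<forall>i. c' $ i \<in> {0..1}) \<and> ($) v \<in> prob_vecs}"
      using C by auto
    then have "compact C"
      using closed_Int_compact[OF \<open>closed C\<close> compact_parameters] by simp
    moreover have "continuous_on C (?r y)"
      unfolding residual_def L2_set_def T_mat_def
      by (intro continuous_intros continuous_on_fst continuous_on_snd continuous_on_id)
    ultimately obtain z where z: "z \<in> C" "\<And>w. w \<in> C \<Longrightarrow> ?r y z \<le> ?r y w"
      using continuous_attains_inf[of C "?r y"] False by blast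
    then have "?r y z > 0"
      using nz[of "fst z" "snd z"] residual_nonneg[of "fst z" g Q' "($) y" "($) (snd z)"] by simp
    then show ?thesis using that z(2) by blast
  qed
  have "\<forall>\<^sub>F x in nhds y. dist x y < \<delta> / 2"
    using \<delta>(1) unfolding eventually_nhds_metric by (intro exI[of _ "\<delta> / 2"]) auto
  then have "\<forall>\<^sub>F x in nhds y. \<forall>(c', v)\<in>C. \<delta> / 2 \<le> residual c' g Q' (($) x) (($) v)"
  proof eventually_elim
    case (elim x)
    have "\<delta> / 2 \<le> ?r x z" if "z \<in> C" for z
      using residual_perturb[of "fst z" g Q' y "($) (snd z)" x] \<delta>(2) elim that
      by (auto simp: dist_commute)
    then show ?case by auto
  qed
  then show ?thesis using \<delta>(1) half_gt_zero by blast
qed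

lemma residual_eq_0_iff:
  assumes "Q_matrix Q"
  shows "residual c g Q \<alpha> p = 0 \<longleftrightarrow> (\<forall>U. U \<noteq> {} \<longrightarrow> moments c g Q p U = \<alpha> U)"
  by (simp add: residual_eq_moments[OF assms] L2_set_eq_0_iff)

text \<open>
  When every attribute is required by two items, all the other items together determine each item.
  Hence the combined estimate for such a matrix consists of moment estimates only.
\<close>

lemma star_items_UNIV:
  fixes Q :: "bool^'k^'m"
  assumes two: "\<And>j. card {i. Q $ i $ j} \<ge> 2"
  shows "star_items Q = UNIV"
proof -
  have "star Q i (UNIV - {i})" for i
  proof -
    obtain j :: 'k where True by blast
    have "\<not> {i'. Q $ i' $ j} \<subseteq> {i}"
      using two[of j] card_mono[of "{i}" "{i'. Q $ i' $ j}"] by auto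
    then have ne: "UNIV - {i} \<noteq> {}" by auto
    have "required Q (insert i (UNIV - {i})) = required Q (UNIV - {i})"
      using covered_by_others[where Q = Q and i = i, OF two] required_insert[of Q i "UNIV - {i}"] by auto
    then show ?thesis
      using ne by (simp add: star_def B_row_eq)
  qed
  then show ?thesis
    by (auto simp: star_items_def)
qed

lemma star_imp_required:
  assumes "Q_matrix Q" and "star Q i U"
  shows "required Q (insert i U) = required Q U"
proof -
  \<comment> \<open>The test profile must be nonzero, since the condition says nothing about the zero
      profile; it is, because U is nonempty and Q has no zero row.\<close>
  let ?A = "\<chi> j. j \<in> required Q U"
  have "required Q (insert i U) \<subseteq> required Q U"
  proof -
    have "?A \<noteq> zero_profile"
      using assms by (auto simp: star_def Q_matrix_def zero_profile_def vec_eq_iff required_def)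
    then have "B_row Q (insert i U) ?A = B_row Q U ?A"
      using assms by (auto simp: star_def)
    then show ?thesis by (simp add: B_row_eq del: One_nat_def)
  qed
  then show ?thesis
    using required_mono[of U "insert i U" Q] by blast
qed


section \<open>The estimators for moments close to the true ones\<close>

text \<open>
  The moment equation of an item with \<open>star Q i U\<close> determines the parameter of this item.
\<close>

lemma moment_ratio:
  assumes "Q_matrix Q" "star Q i U" and pos: "\<And>A. p A > 0" and p: "(\<Sum>A\<in>UNIV. p A) = 1"
    and cg: "\<And>i. c $ i \<noteq> g $ i"
  shows "D_times g U (moments c g Q p) \<noteq> 0"
    and "g $ i + D_times g (insert i U) (moments c g Q p) / D_times g U (moments c g Q p) = c $ i"
proof -
  show ne: "D_times g U (moments c g Q p) \<noteq> 0"
    using cg mastery_pos[of p, OF pos, of "required Q U"] by (simp add: D_times_moments[OF p])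
  have "i \<notin> U" using assms(2) by (simp add: star_def)
  then have "D_times g (insert i U) (moments c g Q p) = (c $ i - g $ i) * D_times g U (moments c g Q p)"
    by (simp add: D_times_moments[OF p] star_imp_required[OF assms(1,2)])
  with ne show "g $ i + D_times g (insert i U) (moments c g Q p) / D_times g U (moments c g Q p) = c $ i"
    by simp
qed

lemma continuous_D_times: "isCont (\<lambda>x. D_times g U (($) x)) y"
  unfolding D_times_def by (intro continuous_intros)

lemma combined_estimate_range:
  "combined_estimate g Q W \<alpha> ch \<Longrightarrow> ch $ i \<in> {0..1}"
  by (auto simp: combined_estimate_def)

text \<open>
  At the true matrix the combined estimate is a continuous function of the moments near the true
  ones, with value \<open>c\<close> there.
\<close>

lemma true_matrix_fits:
  fixes Q :: "bool^'k^'m" and y :: "real^('m::finite set)"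
  assumes Q: "Q_matrix Q" and two: "\<And>j. card {i. Q $ i $ j} \<ge> 2"
    and W: "\<forall>i\<in>star_items Q. star Q i (W i)"
    and pos: "\<And>A. p A > 0" and p: "(\<Sum>A\<in>UNIV. p A) = 1"
    and c01: "\<And>i. c $ i \<in> {0..1}" and cg: "\<And>i. c $ i \<noteq> g $ i"
    and y: "\<And>U. y $ U = moments c g Q p U" and "\<eta> > 0"
  shows "\<forall>\<^sub>F x in nhds y. \<forall>ch. combined_estimate g Q W (($) x) ch \<longrightarrow> residual ch g Q (($) x) p < \<eta>"
proof -
  have y': "($) y = moments c g Q p"
    using y by auto
  have star: "star Q i (W i)" for i
    using W star_items_UNIV[OF two] by auto
  define e where "e x = (\<chi> i. max 0 (min 1
      (g $ i + D_times g (insert i (W i)) (($) x) / D_times g (W i) (($) x))))" for x :: "real^('m set)"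
  have ne: "D_times g (W i) (($) y) \<noteq> 0" for i
    unfolding y' by (rule moment_ratio(1)[OF Q star pos p cg])
  have tendsto: "((\<lambda>x. D_times g U (($) x)) \<longlongrightarrow> D_times g U (($) y)) (nhds y)" for U
    using continuous_D_times[where g = g and U = U and y = y] unfolding isCont_def by (rule tendsto_at_iff_tendsto_nhds[THEN iffD1])
  have "e y = c"
    using c01 moment_ratio(2)[OF Q star pos p cg] by (auto simp: e_def y' vec_eq_iff max_def min_def intro: antisym)
  have "(e \<longlongrightarrow> e y) (nhds y)"
    unfolding e_def by (intro tendsto_intros tendsto ne)
  then have e: "(e \<longlongrightarrow> c) (nhds y)"
    by (simp add: \<open>e y = c\<close>)
  have "((\<lambda>x. residual (e x) g Q (($) x) p) \<longlongrightarrow> residual c g Q (($) y) p) (nhds y)"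
    unfolding residual_def L2_set_def T_mat_def
    by (intro tendsto_intros e filterlim_ident)
  moreover have "residual c g Q (($) y) p = 0"
    using Q by (simp add: residual_eq_0_iff y)
  ultimately have "\<forall>\<^sub>F x in nhds y. residual (e x) g Q (($) x) p < \<eta>"
    using \<open>\<eta> > 0\<close> by (simp add: order_tendstoD)
  moreover have "\<forall>\<^sub>F x in nhds y. \<forall>i. D_times g (W i) (($) x) \<noteq> 0"
    by (intro eventually_all_finite tendsto_imp_eventually_ne[OF tendsto] ne)
  ultimately show ?thesis
  proof eventually_elim
    case (elim x)
    have "ch = e x" if "combined_estimate g Q W (($) x) ch" for ch
      using that elim(2)
      by (auto simp: combined_estimate_def is_arg_min_def moment_estimate_def e_def vec_eq_iff
          star_items_UNIV[OF two])
    with elim(1) show ?case by auto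
  qed
qed

lemma S_fun_le_residual: "p \<in> prob_vecs \<Longrightarrow> S_fun c g Q \<alpha> \<le> residual c g Q \<alpha> p"
  unfolding S_fun_def by (rule cINF_lower) (auto intro!: bdd_belowI residual_nonneg)

lemma le_S_fun:
  fixes Q :: "bool^'k^'m" and p0 :: "bool^'k \<Rightarrow> real"
  assumes "p0 \<in> prob_vecs" "\<And>p. p \<in> prob_vecs \<Longrightarrow> \<delta> \<le> residual c g Q \<alpha> p"
  shows "\<delta> \<le> S_fun c g Q \<alpha>"
  unfolding S_fun_def using assms by (intro cINF_greatest) auto

text \<open>
  A matrix that is not equivalent to \<open>Q\<close> has, for all parameters in the cube, a residual bounded
  away from zero near the true moments, whereas the residual of \<open>Q\<close> tends to zero.
\<close>

lemma Q_estimate_correct: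
  fixes Q :: "bool^'k^'m" and y :: "real^('m::finite set)"
  assumes Q: "Q_matrix Q" and compl: "complete_Q Q" and two: "\<And>j. card {i. Q $ i $ j} \<ge> 2"
    and W: "\<forall>i\<in>star_items Q. star Q i (W Q i)"
    and pos: "\<And>A. p A > 0" and p: "p \<in> prob_vecs"
    and c01: "\<And>i. c $ i \<in> {0..1}" and cg: "\<And>i. c $ i \<noteq> g $ i"
    and y: "\<And>U. y $ U = moments c g Q p U"
  shows "\<forall>\<^sub>F x in nhds y. \<forall>ch Q'.
      (\<forall>Q'. Q_matrix Q' \<longrightarrow> combined_estimate g Q' (W Q') (($) x) (ch Q')) \<longrightarrow>
      is_arg_min (\<lambda>Q'. S_fun (ch Q') g Q' (($) x)) Q_matrix Q' \<longrightarrow> col_equiv Q' Q"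
proof -
  define C where "C = {(c' :: real^'m, v :: real^(bool^'k)). (\<forall>i. c' $ i \<in> {0..1 :: real}) \<and> ($) v \<in> prob_vecs}"
  have "closed C"
    unfolding C_def by (rule compact_imp_closed[OF compact_parameters])
  have p1: "(\<Sum>A\<in>UNIV. p A) = 1"
    using p by (simp add: prob_vecs_def)
  have separated: "\<exists>\<delta>>0. \<forall>\<^sub>F x in nhds y. \<forall>(c', v)\<in>C. \<delta> \<le> residual c' g Q' (($) x) (($) v)"
    if Q': "Q_matrix Q'" "\<not> col_equiv Q' Q" for Q'
  proof (rule residual_bounded_away[OF \<open>closed C\<close>])
    fix c' v assume cv: "(c', v) \<in> C"
    show "residual c' g Q' (($) y) (($) v) \<noteq> 0"
    proof
      assume "residual c' g Q' (($) y) (($) v) = 0"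
      then have eq: "moments c' g Q' (($) v) U = moments c g Q p U" if "U \<noteq> {}" for U
        using that by (simp add: residual_eq_0_iff[OF Q'(1)] y)
      from cv have "($) v \<in> prob_vecs"
        by (simp add: C_def)
      from identifiable(1)[OF compl two pos p this cg eq] Q'(2) show False
        by blast
    qed
  qed (auto simp: C_def)
  have "\<forall>\<^sub>F x in nhds y. Q_matrix Q' \<longrightarrow> \<not> col_equiv Q' Q \<longrightarrow>
      (\<forall>ch ch'. combined_estimate g Q (W Q) (($) x) ch \<longrightarrow> (\<forall>i. ch' $ i \<in> {0..1}) \<longrightarrow>
        S_fun ch g Q (($) x) < S_fun ch' g Q' (($) x))" for Q'
  proof (cases "Q_matrix Q' \<and> \<not> col_equiv Q' Q")
    case True
    then obtain \<delta> where "\<delta> > 0" "\<forall>\<^sub>F x in nhds y. \<forall>(c', v)\<in>C. \<delta> \<le> residual c' g Q' (($) x) (($) v)"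
      using separated by blast
    note this(2)
    moreover have "\<forall>\<^sub>F x in nhds y. \<forall>ch. combined_estimate g Q (W Q) (($) x) ch \<longrightarrow>
        residual ch g Q (($) x) p < \<delta>"
      by (rule true_matrix_fits[OF Q two W pos p1 c01 cg y \<open>\<delta> > 0\<close>])
    ultimately show ?thesis
    proof eventually_elim
      case (elim x)
      have "S_fun ch g Q (($) x) < S_fun ch' g Q' (($) x)"
        if ch: "combined_estimate g Q (W Q) (($) x) ch" and ch': "\<forall>i. ch' $ i \<in> {0..1}" for ch ch'
      proof -
        have "S_fun ch g Q (($) x) \<le> residual ch g Q (($) x) p"
          by (rule S_fun_le_residual[OF p])
        also have "\<dots> < \<delta>"
          using elim(2) ch by blast
        also have "\<delta> \<le> S_fun ch' g Q' (($) x)"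
        proof (rule le_S_fun[OF p])
          fix q :: "bool^'k \<Rightarrow> real" assume q: "q \<in> prob_vecs"
          have "($) (\<chi> A. q A) = q" by auto
          then show "\<delta> \<le> residual ch' g Q' (($) x) q"
            using elim(1)[rule_format, of "(ch', \<chi> A. q A)"] q ch' by (simp add: C_def)
        qed
        finally show ?thesis .
      qed
      then show ?case by blast
    qed
  qed auto
  then have "\<forall>\<^sub>F x in nhds y. \<forall>Q'. Q_matrix Q' \<longrightarrow> \<not> col_equiv Q' Q \<longrightarrow>
      (\<forall>ch ch'. combined_estimate g Q (W Q) (($) x) ch \<longrightarrow> (\<forall>i. ch' $ i \<in> {0..1}) \<longrightarrow>
        S_fun ch g Q (($) x) < S_fun ch' g Q' (($) x))"
    by (rule eventually_all_finite)
  then show ?thesis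
  proof eventually_elim
    case (elim x)
    show ?case
    proof (intro allI impI, rule ccontr)
      fix ch Q'
      assume ch: "\<forall>Q'. Q_matrix Q' \<longrightarrow> combined_estimate g Q' (W Q') (($) x) (ch Q')"
        and min: "is_arg_min (\<lambda>Q'. S_fun (ch Q') g Q' (($) x)) Q_matrix Q'" and ne: "\<not> col_equiv Q' Q"
      from min have Q': "Q_matrix Q'" and "\<not> S_fun (ch Q) g Q (($) x) < S_fun (ch Q') g Q' (($) x)"
        using Q by (auto simp: is_arg_min_def)
      moreover have "\<forall>i. ch Q' $ i \<in> {0..1}"
        using ch Q' combined_estimate_range by blast
      ultimately show False
        using elim ch Q ne by blast
    qed
  qed
qed

text \<open>
  The same comparison for the matrix \<open>Q\<close> itself: profile weights at distance at least
  \<open>\<epsilon>\<close> from \<open>p\<close> have a residual bounded away from zero, for all parameters in the cube.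
\<close>

lemma profile_estimate_close:
  fixes Q :: "bool^'k^'m" and y :: "real^('m::finite set)"
  assumes Q: "Q_matrix Q" and compl: "complete_Q Q" and two: "\<And>j. card {i. Q $ i $ j} \<ge> 2"
    and W: "\<forall>i\<in>star_items Q. star Q i (W i)"
    and pos: "\<And>A. p A > 0" and p: "p \<in> prob_vecs"
    and c01: "\<And>i. c $ i \<in> {0..1}" and cg: "\<And>i. c $ i \<noteq> g $ i"
    and y: "\<And>U. y $ U = moments c g Q p U" and "\<epsilon> > 0"
  shows "\<forall>\<^sub>F x in nhds y. \<forall>ch q. combined_estimate g Q W (($) x) ch \<longrightarrow>
      is_arg_min (residual ch g Q (($) x)) (\<lambda>q. q \<in> prob_vecs) q \<longrightarrow>
      L2_set (\<lambda>A. q A - p A) nonzero_profiles \<le> \<epsilon>"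
proof -
  define C where "C = {(c' :: real^'m, v :: real^(bool^'k)). (\<forall>i. c' $ i \<in> {0..1 :: real}) \<and> ($) v \<in> prob_vecs}
    \<inter> {(c', v). \<epsilon> \<le> L2_set (\<lambda>A. v $ A - p A) nonzero_profiles}"
  have "closed C"
    unfolding C_def case_prod_unfold L2_set_def
    by (intro closed_Int compact_imp_closed[OF compact_parameters[unfolded case_prod_unfold]]
        closed_Collect_le continuous_intros)
  have p1: "(\<Sum>A\<in>UNIV. p A) = 1"
    using p by (simp add: prob_vecs_def)
  have "\<exists>\<delta>>0. \<forall>\<^sub>F x in nhds y. \<forall>(c', v)\<in>C. \<delta> \<le> residual c' g Q (($) x) (($) v)"
  proof (rule residual_bounded_away[OF \<open>closed C\<close>])
    fix c' v assume cv: "(c', v) \<in> C"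
    show "residual c' g Q (($) y) (($) v) \<noteq> 0"
    proof
      assume "residual c' g Q (($) y) (($) v) = 0"
      then have eq: "moments c' g Q (($) v) U = moments c g Q p U" if "U \<noteq> {}" for U
        using that by (simp add: residual_eq_0_iff[OF Q] y)
      from cv have "($) v \<in> prob_vecs"
        by (simp add: C_def)
      from identifiable(2)[OF compl two pos p this cg eq refl] cv \<open>\<epsilon> > 0\<close> show False
        by (simp add: C_def L2_set_def)
    qed
  qed (auto simp: C_def)
  then obtain \<delta> where "\<delta> > 0"
      "\<forall>\<^sub>F x in nhds y. \<forall>(c', v)\<in>C. \<delta> \<le> residual c' g Q (($) x) (($) v)"
    by blast
  note this(2)
  moreover have "\<forall>\<^sub>F x in nhds y. \<forall>ch. combined_estimate g Q W (($) x) ch \<longrightarrow>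
      residual ch g Q (($) x) p < \<delta>"
    by (rule true_matrix_fits[OF Q two W pos p1 c01 cg y \<open>\<delta> > 0\<close>])
  ultimately show ?thesis
  proof eventually_elim
    case (elim x)
    show ?case
    proof (intro allI impI, rule ccontr)
      fix ch q
      assume ch: "combined_estimate g Q W (($) x) ch"
        and min: "is_arg_min (residual ch g Q (($) x)) (\<lambda>q. q \<in> prob_vecs) q"
        and far: "\<not> L2_set (\<lambda>A. q A - p A) nonzero_profiles \<le> \<epsilon>"
      have q: "q \<in> prob_vecs"
        using min by (simp add: is_arg_min_def)
      have "residual ch g Q (($) x) q \<le> residual ch g Q (($) x) p"
        using min p by (auto simp: is_arg_min_def not_less)
      also have "\<dots> < \<delta>"
        using elim(2) ch by blast
      also have "\<delta> \<le> residual ch g Q (($) x) q"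
      proof -
        have "($) (\<chi> A. q A) = q" by auto
        then show ?thesis
          using elim(1)[rule_format, of "(ch, \<chi> A. q A)"] q far combined_estimate_range[OF ch]
          by (simp add: C_def)
      qed
      finally show False by simp
    qed
  qed
qed

section \<open>The law of the responses\<close>

lemma sum_response_patterns:
  fixes q :: "'m::finite \<Rightarrow> bool \<Rightarrow> real"
  assumes "\<And>i. q i True + q i False = 1"
  shows "(\<Sum>x | \<forall>i\<in>U. x $ i. \<Prod>i\<in>UNIV. q i (x $ i)) = (\<Prod>i\<in>U. q i True)"
proof -
  let ?B = "\<lambda>i. if i \<in> U then {True} else UNIV"
  have "bij_betw ($) {x :: bool^'m. \<forall>i\<in>U. x $ i} (PiE UNIV ?B)"
    by (intro bij_betw_byWitness[where f' = vec_lambda]) (auto simp: vec_lambda_inverse PiE_iff split: if_splits)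
  then have "(\<Sum>x | \<forall>i\<in>U. x $ i. \<Prod>i\<in>UNIV. q i (x $ i)) = (\<Sum>f\<in>PiE UNIV ?B. \<Prod>i\<in>UNIV. q i (f i))"
    by (rule sum.reindex_bij_betw)
  also have "\<dots> = (\<Prod>i\<in>UNIV. \<Sum>b\<in>?B i. q i b)"
    by (subst prod_sum_PiE) auto
  also have "\<dots> = (\<Prod>i\<in>UNIV. if i \<in> U then q i True else 1)"
    using assms by (intro prod.cong) (auto simp: UNIV_bool add.commute)
  also have "\<dots> = (\<Prod>i\<in>U. q i True)"
    by (simp add: prod.If_cases)
  finally show ?thesis .
qed

lemma (in prob_space) subject_measurable:
  assumes "independent_subjects M A R"
  shows "{\<omega> \<in> space M. \<phi> (A r \<omega>) (R r \<omega>)} \<in> events"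
proof -
  have "random_variable (count_space UNIV) (\<lambda>\<omega>. (A r \<omega>, R r \<omega>))"
    using assms by (auto simp: independent_subjects_def indep_vars_def)
  from measurable_sets[OF this, of "{(a, b). \<phi> a b}"]
  show ?thesis by (simp add: vimage_def Int_def conj_commute)
qed

text \<open>
  Joint independence is given for complete response patterns; summing over the patterns that are
  positive on \<open>U\<close> yields the product formula for \<open>U\<close>.
\<close>

lemma (in prob_space) positive_responses_given_ideal:
  fixes Q :: "bool^'k^'m"
  assumes subj: "independent_subjects M A R" and model: "response_model M Q c g A R"
    and z: "\<P>(\<omega> in M. ideal_vec Q (A r \<omega>) = z) > 0"
  shows "\<P>(\<omega> in M. (\<forall>i\<in>U. R r \<omega> $ i) \<and> ideal_vec Q (A r \<omega>) = z)
       = (\<Prod>i\<in>U. c $ i ^ (z $ i) * g $ i ^ (1 - z $ i)) * \<P>(\<omega> in M. ideal_vec Q (A r \<omega>) = z)"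
proof -
  let ?Z = "\<lambda>\<omega>. ideal_vec Q (A r \<omega>) = z"
  let ?pz = "\<P>(\<omega> in M. ?Z \<omega>)"
  note [measurable] = subject_measurable[OF subj]
  define q where "q i b = \<P>(\<omega> in M. R r \<omega> $ i = b \<bar> ?Z \<omega>)" for i b
  have joint: "\<P>(\<omega> in M. R r \<omega> = x \<bar> ?Z \<omega>) = (\<Prod>i\<in>UNIV. q i (x $ i))" for x
    using model z unfolding response_model_def q_def by blast
  have marginal: "q i True = c $ i ^ (z $ i) * g $ i ^ (1 - z $ i)" for i
    using model z unfolding response_model_def q_def by simp
  have total: "q i True + q i False = 1" for i
  proof -
    have "?pz = prob ({\<omega> \<in> space M. R r \<omega> $ i = True \<and> ?Z \<omega>} \<union> {\<omega> \<in> space M. R r \<omega> $ i = False \<and> ?Z \<omega>})"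
      by (rule arg_cong[where f = prob]) auto
    also have "\<dots> = \<P>(\<omega> in M. R r \<omega> $ i = True \<and> ?Z \<omega>) + \<P>(\<omega> in M. R r \<omega> $ i = False \<and> ?Z \<omega>)"
      by (rule finite_measure_Union)
        (use subject_measurable[OF subj, where r = r and \<phi> = "\<lambda>a b. b $ i = True \<and> ideal_vec Q a = z"]
             subject_measurable[OF subj, where r = r and \<phi> = "\<lambda>a b. b $ i = False \<and> ideal_vec Q a = z"] in auto)
    finally show ?thesis
      using z unfolding q_def cond_prob_def by (simp add: add_divide_distrib[symmetric])
  qed
  have "{\<omega> \<in> space M. (\<forall>i\<in>U. R r \<omega> $ i) \<and> ?Z \<omega>}
      = (\<Union>x\<in>{x. \<forall>i\<in>U. x $ i}. {\<omega> \<in> space M. R r \<omega> = x \<and> ?Z \<omega>})"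
    by auto
  then have "\<P>(\<omega> in M. (\<forall>i\<in>U. R r \<omega> $ i) \<and> ?Z \<omega>)
      = (\<Sum>x | \<forall>i\<in>U. x $ i. \<P>(\<omega> in M. R r \<omega> = x \<and> ?Z \<omega>))"
    using subject_measurable[OF subj, where r = r and \<phi> = "\<lambda>a b. b = _ \<and> ideal_vec Q a = z"]
    by (simp only:) (rule finite_measure_finite_Union, auto simp: disjoint_family_on_def)
  also have "\<dots> = (\<Sum>x | \<forall>i\<in>U. x $ i. (\<Prod>i\<in>UNIV. q i (x $ i)) * ?pz)"
    using z joint unfolding cond_prob_def by (intro sum.cong) (auto simp: field_simps)
  also have "\<dots> = (\<Prod>i\<in>U. q i True) * ?pz"
    by (simp only: sum_distrib_right[symmetric] sum_response_patterns[where q = q, OF total])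
  finally show ?thesis
    by (simp add: marginal)
qed

lemma (in prob_space) positive_responses_prob:
  fixes Q :: "bool^'k^'m"
  assumes prof: "iid_profiles M A pstar" and pos: "\<And>a. pstar a > 0"
    and subj: "independent_subjects M A R" and model: "response_model M Q c g A R"
  shows "\<P>(\<omega> in M. \<forall>i\<in>U. R r \<omega> $ i) = moments c g Q pstar U"
proof -
  let ?Z = "\<lambda>z \<omega>. ideal_vec Q (A r \<omega>) = z"
  have prob_A: "\<P>(\<omega> in M. A r \<omega> = a) = pstar a" for a
    using prof by (simp add: iid_profiles_def)
  have prob_Z: "\<P>(\<omega> in M. ?Z z \<omega>) = (\<Sum>a | ideal_vec Q a = z. pstar a)" for z
  proof -
    have "{\<omega> \<in> space M. ?Z z \<omega>} = (\<Union>a\<in>{a. ideal_vec Q a = z}. {\<omega> \<in> space M. A r \<omega> = a})"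
      by auto
    then have "\<P>(\<omega> in M. ?Z z \<omega>) = (\<Sum>a | ideal_vec Q a = z. \<P>(\<omega> in M. A r \<omega> = a))"
      using subject_measurable[OF subj, where r = r and \<phi> = "\<lambda>a b. a = _"]
      by (simp only:) (rule finite_measure_finite_Union, auto simp: disjoint_family_on_def)
    then show ?thesis by (simp add: prob_A)
  qed
  have entry: "(\<Prod>i\<in>U. c $ i ^ (ideal_vec Q a $ i) * g $ i ^ (1 - ideal_vec Q a $ i)) = T_mat c g Q U a" for a
    unfolding T_mat_def ideal_vec_def by (intro prod.cong) (auto simp: ideal_eq)
  have "{\<omega> \<in> space M. \<forall>i\<in>U. R r \<omega> $ i}
      = (\<Union>z\<in>range (ideal_vec Q). {\<omega> \<in> space M. (\<forall>i\<in>U. R r \<omega> $ i) \<and> ?Z z \<omega>})"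
    by auto
  then have "\<P>(\<omega> in M. \<forall>i\<in>U. R r \<omega> $ i)
      = (\<Sum>z\<in>range (ideal_vec Q). \<P>(\<omega> in M. (\<forall>i\<in>U. R r \<omega> $ i) \<and> ?Z z \<omega>))"
    using subject_measurable[OF subj, where r = r and \<phi> = "\<lambda>a b. (\<forall>i\<in>U. b $ i) \<and> ideal_vec Q a = _"]
    by (simp only:) (rule finite_measure_finite_Union, auto simp: disjoint_family_on_def)
  also have "\<dots> = (\<Sum>z\<in>range (ideal_vec Q). \<Sum>a | ideal_vec Q a = z. T_mat c g Q U a * pstar a)"
  proof (rule sum.cong[OF refl])
    fix z assume "z \<in> range (ideal_vec Q)"
    then have "(\<Sum>a | ideal_vec Q a = z. pstar a) > 0"
      using pos by (intro sum_pos) auto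
    then have "\<P>(\<omega> in M. (\<forall>i\<in>U. R r \<omega> $ i) \<and> ?Z z \<omega>)
       = (\<Prod>i\<in>U. c $ i ^ (z $ i) * g $ i ^ (1 - z $ i)) * (\<Sum>a | ideal_vec Q a = z. pstar a)"
      using positive_responses_given_ideal[OF subj model, where r = r and z = z and U = U] by (simp add: prob_Z)
    also have "\<dots> = (\<Sum>a | ideal_vec Q a = z. T_mat c g Q U a * pstar a)"
      unfolding sum_distrib_left by (intro sum.cong) (auto simp: entry simp del: One_nat_def)
    finally show "\<P>(\<omega> in M. (\<forall>i\<in>U. R r \<omega> $ i) \<and> ?Z z \<omega>)
       = (\<Sum>a | ideal_vec Q a = z. T_mat c g Q U a * pstar a)" .
  qed
  also have "\<dots> = moments c g Q pstar U"
    unfolding moments_def using sum.image_gen[of UNIV "\<lambda>a. T_mat c g Q U a * pstar a" "ideal_vec Q"] by simp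
  finally show ?thesis .
qed

lemma (in prob_space) profile_distribution_prob_vec:
  fixes A :: "nat \<Rightarrow> 'a \<Rightarrow> bool^'k"
  assumes prof: "iid_profiles M A pstar" and pos: "\<And>a. pstar a > 0"
    and subj: "independent_subjects M A R"
  shows "pstar \<in> prob_vecs"
proof -
  have prob_A: "\<P>(\<omega> in M. A r \<omega> = a) = pstar a" for r a
    using prof by (simp add: iid_profiles_def)
  have "space M = (\<Union>a. {\<omega> \<in> space M. A 0 \<omega> = a})" by auto
  then have "prob (space M) = prob (\<Union>a. {\<omega> \<in> space M. A 0 \<omega> = a})" by simp
  also have "\<dots> = (\<Sum>a\<in>UNIV. \<P>(\<omega> in M. A 0 \<omega> = a))"
    using subject_measurable[OF subj, where r = 0 and \<phi> = "\<lambda>a b. a = _"]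
    by (intro finite_measure_finite_Union) (auto simp: disjoint_family_on_def)
  finally have "(\<Sum>a\<in>UNIV. pstar a) = 1"
    by (simp add: prob_A prob_space)
  moreover have "pstar a \<le> 1" for a
    unfolding prob_A[of 0 a, symmetric] by simp
  ultimately show ?thesis
    using pos by (simp add: prob_vecs_def less_imp_le)
qed

section \<open>Convergence in probability of the empirical moments\<close>

text \<open>
  Hoeffding's inequality for relative frequencies.
\<close>

lemma (in prob_space) frequency_deviation:
  fixes R :: "nat \<Rightarrow> 'a \<Rightarrow> 'b" and N :: nat and \<delta> :: real
  assumes indep: "indep_vars (\<lambda>_. count_space UNIV) R UNIV"
    and q: "\<And>r. \<P>(\<omega> in M. \<phi> (R r \<omega>)) = q" and "\<delta> \<ge> 0" "N > 0"
  shows "\<P>(\<omega> in M. \<bar>real (card {r. r < N \<and> \<phi> (R r \<omega>)}) / N - q\<bar> \<ge> \<delta>) \<le> 2 * exp (- (2 * real N * \<delta>\<^sup>2))"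
proof -
  define X where "X r \<omega> = (of_bool (\<phi> (R r \<omega>)) :: real)" for r \<omega>
  have rv: "random_variable (count_space UNIV) (R r)" for r
    using indep by (auto simp: indep_vars_def)
  have meas: "{\<omega> \<in> space M. \<phi> (R r \<omega>)} \<in> events" for r
    using measurable_sets[OF rv, of "{x. \<phi> x}"] by (simp add: vimage_def Int_def conj_commute)
  have X: "X r = (\<lambda>\<omega>. (of_bool \<circ> \<phi>) (R r \<omega>))" for r
    by (simp add: X_def fun_eq_iff)
  have "indep_vars (\<lambda>_. borel) (\<lambda>r \<omega>. (of_bool \<circ> \<phi>) (R r \<omega>)) UNIV"
    by (rule indep_vars_compose2[OF indep]) auto
  then have indep_X: "indep_vars (\<lambda>_. borel) X {..<N}"
    unfolding X[abs_def] by (rule indep_vars_subset) auto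
  interpret Hoeffding_ineq M "{..<N}" X "\<lambda>_. 0" "\<lambda>_. 1" "\<Sum>r\<in>{..<N}. expectation (X r)"
    by unfold_locales (auto simp: indep_X X_def)
  have "expectation (X r) = q" for r
  proof -
    have "expectation (X r) = expectation (indicator {\<omega> \<in> space M. \<phi> (R r \<omega>)})"
      by (intro Bochner_Integration.integral_cong) (auto simp: X_def)
    then show ?thesis
      using meas[of r] q[of r] by simp
  qed
  moreover have "(\<Sum>r<N. X r \<omega>) = card {r. r < N \<and> \<phi> (R r \<omega>)}" for \<omega>
    by (simp add: X_def sum.If_cases of_bool_def Int_def)
  moreover have "\<delta> * N \<le> \<bar>x - N * q\<bar> \<longleftrightarrow> \<delta> \<le> \<bar>x / N - q\<bar>" for x
  proof -
    have "x / N - q = (x - N * q) / N"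
      using \<open>N > 0\<close> by (simp add: field_simps)
    then show ?thesis
      using \<open>N > 0\<close> by (simp add: le_divide_eq)
  qed
  moreover have "2 * (\<delta> * N)\<^sup>2 / N = 2 * (N * \<delta>\<^sup>2)"
    using \<open>N > 0\<close> by (simp add: power2_eq_square)
  ultimately show ?thesis
    using Hoeffding_ineq_abs_ge[of "\<delta> * N"] \<open>\<delta> \<ge> 0\<close> \<open>N > 0\<close> by (simp add: mult_ac)
qed

text \<open>
  Every event determined by a sample is measurable, since there are finitely many samples of a given
  size.  No measurability of the estimators is needed.
\<close>

lemma (in prob_space) sample_measurable:
  fixes R :: "nat \<Rightarrow> 'a \<Rightarrow> bool^'m"
  assumes "\<And>r. random_variable (count_space UNIV) (R r)"
  shows "{\<omega> \<in> space M. \<phi> (sample R N \<omega>)} \<in> events"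
proof -
  have eq: "{\<omega> \<in> space M. \<phi> (sample R N \<omega>)}
      = (\<Union>xs\<in>{xs. set xs \<subseteq> UNIV \<and> length xs = N \<and> \<phi> xs}. {\<omega> \<in> space M. \<forall>r\<in>{..<N}. R r \<omega> = xs ! r})"
    (is "?L = ?R")
  proof (intro set_eqI iffI)
    fix \<omega> assume "\<omega> \<in> ?R"
    then obtain xs where "length xs = N" "\<phi> xs" "\<omega> \<in> space M" "\<forall>r\<in>{..<N}. R r \<omega> = xs ! r"
      by blast
    moreover from this have "sample R N \<omega> = xs"
      by (auto simp: sample_def intro!: nth_equalityI)
    ultimately show "\<omega> \<in> ?L" by simp
  next
    fix \<omega> assume "\<omega> \<in> ?L"
    then show "\<omega> \<in> ?R"
      by (intro UN_I[of "sample R N \<omega>"]) (auto simp: sample_def)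
  qed
  have "finite {xs :: (bool^'m) list. set xs \<subseteq> UNIV \<and> length xs = N \<and> \<phi> xs}"
    by (rule finite_subset[OF _ finite_lists_length_eq[of UNIV N]]) auto
  moreover have "{\<omega> \<in> space M. \<forall>r\<in>{..<N}. R r \<omega> = xs ! r} \<in> events" for xs
  proof (rule sets.sets_Collect_finite_All)
    fix r
    show "{\<omega> \<in> space M. R r \<omega> = xs ! r} \<in> events"
      using measurable_sets[OF assms[of r], of "{xs ! r}"] by (simp add: vimage_def Int_def conj_commute)
  qed auto
  ultimately show ?thesis
    unfolding eq by (intro sets.finite_UN) auto
qed

lemma alpha_vec_sample:
  "alpha_vec (sample R N \<omega>) U = real (card {r. r < N \<and> (\<forall>i\<in>U. R r \<omega> $ i)}) / N"
proof -
  have "{r. r < length (sample R N \<omega>) \<and> (\<forall>i\<in>U. sample R N \<omega> ! r $ i)} = {r. r < N \<and> (\<forall>i\<in>U. R r \<omega> $ i)}"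
    by (auto simp: sample_def)
  then show ?thesis
    by (simp add: alpha_vec_def) (simp add: sample_def)
qed

text \<open>
  A property of samples that holds whenever the empirical moments are close to the true ones holds
  with probability tending to one.
\<close>

lemma (in prob_space) prob_near_moments_tendsto_1:
  fixes R :: "nat \<Rightarrow> 'a \<Rightarrow> bool^'m" and y :: "real^('m::finite set)"
  assumes indep: "indep_vars (\<lambda>_. count_space UNIV) R UNIV"
    and y: "\<And>r U. \<P>(\<omega> in M. \<forall>i\<in>U. R r \<omega> $ i) = y $ U"
    and near: "\<forall>\<^sub>F x in nhds y. \<forall>xs. alpha_vec xs = ($) x \<longrightarrow> \<phi> xs"
  shows "(\<lambda>N. \<P>(\<omega> in M. \<phi> (sample R N \<omega>))) \<longlonglongrightarrow> 1"
proof -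
  have rv: "random_variable (count_space UNIV) (R r)" for r
    using indep by (auto simp: indep_vars_def)
  note meas = sample_measurable[where R = R, OF rv]
  obtain \<epsilon> where "\<epsilon> > 0" and \<epsilon>: "\<And>x xs. dist x y < \<epsilon> \<Longrightarrow> alpha_vec xs = ($) x \<Longrightarrow> \<phi> xs"
    using near unfolding eventually_nhds_metric by blast
  define n where "n = real CARD('m set)"
  have "n > 0" by (simp add: n_def)
  define \<delta> where "\<delta> = \<epsilon> / (2 * n)"
  have "\<delta> > 0" using \<open>\<epsilon> > 0\<close> \<open>n > 0\<close> by (simp add: \<delta>_def)
  have good: "\<phi> xs" if "\<And>U. \<bar>alpha_vec xs U - y $ U\<bar> < \<delta>" for xs
  proof (rule \<epsilon>)
    let ?x = "\<chi> U. alpha_vec xs U"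
    have "dist ?x y \<le> (\<Sum>U\<in>UNIV. \<bar>(?x - y) $ U\<bar>)"
      unfolding dist_norm by (rule norm_le_l1_cart)
    also have "\<dots> \<le> (\<Sum>U\<in>(UNIV :: 'm set set). \<delta>)"
      using that by (intro sum_mono) (simp add: less_imp_le)
    also have "\<dots> = \<epsilon> / 2"
      using \<open>n > 0\<close> by (simp add: \<delta>_def n_def)
    finally show "dist ?x y < \<epsilon>"
      using \<open>\<epsilon> > 0\<close> by simp
  qed auto
  have lower: "1 - n * (2 * exp (- (2 * real N * \<delta>\<^sup>2))) \<le> \<P>(\<omega> in M. \<phi> (sample R N \<omega>))" if "N > 0" for N
  proof -
    let ?bad = "\<lambda>U. {\<omega> \<in> space M. \<bar>alpha_vec (sample R N \<omega>) U - y $ U\<bar> \<ge> \<delta>}"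
    have "1 - \<P>(\<omega> in M. \<phi> (sample R N \<omega>)) = prob (space M - {\<omega> \<in> space M. \<phi> (sample R N \<omega>)})"
      by (rule prob_compl[symmetric, OF meas])
    also have "\<dots> \<le> prob (\<Union>U. ?bad U)"
    proof (rule finite_measure_mono)
      show "space M - {\<omega> \<in> space M. \<phi> (sample R N \<omega>)} \<subseteq> (\<Union>U. ?bad U)"
      proof
        fix \<omega> assume \<omega>: "\<omega> \<in> space M - {\<omega> \<in> space M. \<phi> (sample R N \<omega>)}"
        then obtain U where "\<not> \<bar>alpha_vec (sample R N \<omega>) U - y $ U\<bar> < \<delta>"
          using good[of "sample R N \<omega>"] by blast
        with \<omega> show "\<omega> \<in> (\<Union>U. ?bad U)" by (auto simp: not_less)
      qed
      show "(\<Union>U. ?bad U) \<in> events"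
        by (intro sets.finite_UN meas) auto
    qed
    also have "\<dots> \<le> (\<Sum>U\<in>UNIV. prob (?bad U))"
      by (rule finite_measure_subadditive_finite) (auto intro!: meas)
    also have "\<dots> \<le> (\<Sum>U\<in>(UNIV :: 'm set set). 2 * exp (- (2 * real N * \<delta>\<^sup>2)))"
    proof (rule sum_mono)
      fix U
      show "prob (?bad U) \<le> 2 * exp (- (2 * real N * \<delta>\<^sup>2))"
        unfolding alpha_vec_sample
        by (rule frequency_deviation[OF indep, where \<phi> = "\<lambda>x. \<forall>i\<in>U. x $ i"])
          (use y \<open>\<delta> > 0\<close> \<open>N > 0\<close> in auto)
    qed
    finally show ?thesis by (simp add: n_def)
  qed
  have "(\<lambda>N. 1 - n * (2 * exp (- (2 * real N * \<delta>\<^sup>2)))) \<longlonglongrightarrow> 1 - n * (2 * 0)"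
  proof (intro tendsto_intros filterlim_compose[OF exp_at_bot])
    have "filterlim (\<lambda>N. real N * (2 * \<delta>\<^sup>2)) at_top sequentially"
      using \<open>\<delta> > 0\<close> by (intro filterlim_at_top_mult_tendsto_pos[OF tendsto_const _ filterlim_real_sequentially]) simp
    then show "filterlim (\<lambda>N. - (2 * real N * \<delta>\<^sup>2)) at_bot sequentially"
      by (simp add: filterlim_uminus_at_bot mult_ac)
  qed
  then have lim: "(\<lambda>N. 1 - n * (2 * exp (- (2 * real N * \<delta>\<^sup>2)))) \<longlonglongrightarrow> 1" by simp
  show ?thesis
    by (rule tendsto_sandwich[OF _ _ lim tendsto_const])
      (use lower in \<open>auto intro: eventually_sequentiallyI[of 1]\<close>)
qed

section \<open>Consistency\<close>

theorem theorem4p2: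
  fixes M :: "'w measure"
    and Q :: "bool^'k^'m" and c g :: "real^'m"
    and A :: "nat \<Rightarrow> 'w \<Rightarrow> bool^'k" and R :: "nat \<Rightarrow> 'w \<Rightarrow> bool^'m"
    and pstar :: "bool^'k \<Rightarrow> real"
    and W :: "bool^'k^'m \<Rightarrow> 'm \<Rightarrow> 'm set"
    and chat :: "(bool^'m) list \<Rightarrow> bool^'k^'m \<Rightarrow> real^'m"
    and Qhat :: "(bool^'m) list \<Rightarrow> bool^'k^'m"
  assumes "prob_space M"
    and "Q_matrix Q"
    and "\<forall>i. g $ i \<in> {0..1}" and "\<forall>i. c $ i \<in> {0..1}"
    and "complete_Q Q"
    and "iid_profiles M A pstar"
    and "\<forall>a. pstar a > 0"
    and "\<forall>j. card {i. Q $ i $ j} \<ge> 2"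
    and "independent_subjects M A R"
    and "response_model M Q c g A R"
    and "\<forall>i. c $ i \<noteq> g $ i"
    and "\<forall>U\<in>combinations. (\<Sum>a\<in>nonzero_profiles. T_mat (c - g) 0 Q U a * pstar a) \<noteq> 0"
    and "\<forall>Q'. Q_matrix Q' \<longrightarrow> (\<forall>i\<in>star_items Q'. star Q' i (W Q' i))"
    and "\<forall>xs Q'. Q_matrix Q' \<longrightarrow> combined_estimate g Q' (W Q') (alpha_vec xs) (chat xs Q')"
    and "\<forall>xs. is_arg_min (\<lambda>Q'. S_fun (chat xs Q') g Q' (alpha_vec xs)) Q_matrix (Qhat xs)"
  shows "((\<lambda>N. \<P>(\<omega> in M. col_equiv (Qhat (sample R N \<omega>)) Q)) \<longlonglongrightarrow> 1) \<and>
    (\<forall>ctilde Qhat' ptilde.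
       (\<forall>xs. is_arg_min (\<lambda>c'. S_fun c' g Q (alpha_vec xs)) (\<lambda>c'. \<forall>i. c' $ i \<in> {0..1}) (ctilde xs)) \<longrightarrow>
       consistent_estimator M R ctilde c \<longrightarrow>
       (\<forall>xs. col_equiv (Qhat xs) (Qhat' xs) \<and> (col_equiv (Qhat xs) Q \<longrightarrow> Qhat' xs = Q)) \<longrightarrow>
       (\<forall>xs. is_arg_min (residual (chat xs (Qhat' xs)) g (Qhat' xs) (alpha_vec xs))
               (\<lambda>p. p \<in> prob_vecs) (ptilde xs)) \<longrightarrow>
       (\<forall>\<epsilon>>0. (\<lambda>N. \<P>(\<omega> in M.
           L2_set (\<lambda>a. ptilde (sample R N \<omega>) a - pstar a) nonzero_profiles \<le> \<epsilon>)) \<longlonglongrightarrow> 1))"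
proof -
  interpret prob_space M by fact
  note subj = \<open>independent_subjects M A R\<close>
  have Q: "Q_matrix Q" and compl: "complete_Q Q" by fact+
  have two: "\<And>j. card {i. Q $ i $ j} \<ge> 2" and pos: "\<And>a. pstar a > 0"
    and c01: "\<And>i. c $ i \<in> {0..1}" and cg: "\<And>i. c $ i \<noteq> g $ i"
    and W: "\<forall>i\<in>star_items Q. star Q i (W Q i)"
    using assms(4,7,8,11,13) Q by blast+
  have chat: "\<And>xs Q'. Q_matrix Q' \<Longrightarrow> combined_estimate g Q' (W Q') (alpha_vec xs) (chat xs Q')"
    using assms(14) by blast
  have Qhat: "\<And>xs. is_arg_min (\<lambda>Q'. S_fun (chat xs Q') g Q' (alpha_vec xs)) Q_matrix (Qhat xs)"
    using assms(15) by blast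
  have p: "pstar \<in> prob_vecs"
    by (rule profile_distribution_prob_vec[OF \<open>iid_profiles M A pstar\<close> pos subj])
  define y where "y = (\<chi> U. moments c g Q pstar U)"
  have y: "y $ U = moments c g Q pstar U" for U
    by (simp add: y_def)
  have indep: "indep_vars (\<lambda>_. count_space UNIV) R UNIV"
    using indep_vars_compose2[OF subj[unfolded independent_subjects_def], where Y = "\<lambda>_. snd"] by simp
  have "\<P>(\<omega> in M. \<forall>i\<in>U. R r \<omega> $ i) = y $ U" for r U
    unfolding y using assms(6,10) pos subj by (intro positive_responses_prob)
  note lim = prob_near_moments_tendsto_1[OF indep this]
  have Q_near: "\<forall>\<^sub>F x in nhds y. \<forall>xs. alpha_vec xs = ($) x \<longrightarrow> col_equiv (Qhat xs) Q"
    using Q_estimate_correct[where W = W, OF Q compl two W pos p c01 cg y]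
  proof eventually_elim
    case (elim x)
    have "col_equiv (Qhat xs) Q" if xs: "alpha_vec xs = ($) x" for xs
      using elim chat Qhat[of xs] unfolding xs[symmetric] by blast
    then show ?case by blast
  qed
  show ?thesis
  proof (intro conjI allI impI)
    show "(\<lambda>N. \<P>(\<omega> in M. col_equiv (Qhat (sample R N \<omega>)) Q)) \<longlonglongrightarrow> 1"
      by (rule lim[OF Q_near])
  next
    fix Qhat' :: "(bool^'m) list \<Rightarrow> bool^'k^'m" and ptilde :: "(bool^'m) list \<Rightarrow> bool^'k \<Rightarrow> real"
      and \<epsilon> :: real
    assume Qhat': "\<forall>xs. col_equiv (Qhat xs) (Qhat' xs) \<and> (col_equiv (Qhat xs) Q \<longrightarrow> Qhat' xs = Q)"
      and ptilde: "\<forall>xs. is_arg_min (residual (chat xs (Qhat' xs)) g (Qhat' xs) (alpha_vec xs))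
               (\<lambda>p. p \<in> prob_vecs) (ptilde xs)"
      and "\<epsilon> > 0"
    have "\<forall>\<^sub>F x in nhds y. \<forall>xs. alpha_vec xs = ($) x \<longrightarrow>
        L2_set (\<lambda>a. ptilde xs a - pstar a) nonzero_profiles \<le> \<epsilon>"
      using Q_near profile_estimate_close[where W = "W Q", OF Q compl two W pos p c01 cg y \<open>\<epsilon> > 0\<close>]
    proof eventually_elim
      case (elim x)
      have "L2_set (\<lambda>a. ptilde xs a - pstar a) nonzero_profiles \<le> \<epsilon>" if xs: "alpha_vec xs = ($) x" for xs
      proof -
        have "Qhat' xs = Q"
          using elim(1) Qhat' xs by blast
        then show ?thesis
          using elim(2) ptilde[rule_format, of xs] chat[OF Q, of xs] by (simp add: xs)
      qed
      then show ?case by blast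
    qed
    then show "(\<lambda>N. \<P>(\<omega> in M.
        L2_set (\<lambda>a. ptilde (sample R N \<omega>) a - pstar a) nonzero_profiles \<le> \<epsilon>)) \<longlonglongrightarrow> 1"
      by (rule lim)
  qed
qed

end
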